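(* There are at least $44$ pairwise non-isomorphic $3$-$(80,16,665)$ designs.
   Context: A $3$-$(v,k,\mu)$ design consists of a set of $v$ points together with a collection of $k$-element subsets (blocks) of the point set such that every $3$-element subset of points is contained in exactly $\mu$ blocks. Two designs are isomorphic if there is a bijection between their point sets that maps the blocks of one onto the blocks of the other. *)

theory Defs
  imports Main
begin

text \<open>An incidence structure is a pair of a point set and a block set. Blocks form a set, so
  repeated blocks are excluded.\<close>

type_synonym 'a incidence_structure = "'a set \<times> 'a set set"

definition is_3_design :: "nat \<Rightarrow> nat \<Rightarrow> nat \<Rightarrow> 'a incidence_structure \<Rightarrow> bool" where
  "is_3_design v k \<mu> = (\<lambda>(V, \<B>).
     finite V \<and> card V = v \<and>
     (\<forall>B\<in>\<B>. B \<subseteq> V \<and> card B = k) \<and>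
     (\<forall>T. T \<subseteq> V \<and> card T = 3 \<longrightarrow> card {B\<in>\<B>. T \<subseteq> B} = \<mu>))"

definition isomorphic :: "'a incidence_structure \<Rightarrow> 'b incidence_structure \<Rightarrow> bool" where
  "isomorphic = (\<lambda>(V, \<B>) (W, \<C>). \<exists>f. bij_betw f V W \<and> (`) f ` \<B> = \<C>)"

end

theory Submission
  imports Defs "HOL-Library.FuncSet" "HOL-Combinatorics.Permutations"
    "Berlekamp_Zassenhaus.Finite_Field"
begin

text \<open>
  Every design below is a union of two smaller ones on the projective line over the field with
  79 elements. Since \<open>79 \<equiv> 3\<close> modulo 4, the group \<open>PSL(2, 79)\<close> is transitive on the 3-subsets of
  the line (\<open>PSL_3_homogeneous\<close>), so the images of any 16-point block under the group form a
  3-design. A block with a dihedral stabilizer of order 16 yields a 3-(80, 16, 105) design, and one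
  with a stabilizer of order 3 yields a 3-(80, 16, 560) design. If the first design is kept in place
  and a permutation \<open>\<rho>\<close> of the points moves the second one to a position in which the two share no
  block, then their union is a 3-(80, 16, 665) design.

  These unions are told apart by counting and not by invariants. Each of the two orbit designs has
  three points and 15 blocks through them such that these blocks separate the other points. A map
  that embeds the orbit design into a 3-(80, 16, 665) design \<open>E\<close> is then known as soon as the
  images of the three points are known, together with the images of the 15 blocks; and these images
  lie among the 665 blocks of \<open>E\<close> that contain the three image points. An isomorphism from the
  union onto \<open>E\<close> embeds both parts and thereby determines \<open>\<rho>\<close>. Hence at most
  \<open>(80\<^sup>3 \<cdot> 665\<^sup>1\<^sup>5)\<^sup>2\<close> permutations lead to designs isomorphic to \<open>E\<close>. This is so small in
  comparison with \<open>80!\<close> that 43 isomorphism classes cannot account for all permutations, even after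
  those that make the two parts overlap are discarded (\<open>many_nonisomorphic_merges\<close>).

  The parameter of an orbit design is found without enumerating its blocks. Double counting forces
  it to be \<open>35 m\<close>, with \<open>1027 m\<close> blocks through each point and \<open>5135 m\<close> blocks in all. As the group has
  order at most \<open>48 \<cdot> 5135\<close>, a stabilizer of order \<open>h\<close> gives \<open>m \<le> 48 / h\<close>. For the opposite bound, affine
  maps act on the blocks through infinity, and power sums of the finite points of such blocks show
  that certain affine orbits are regular and distinct (\<open>blocks_through_infinity_ge\<close>,
  \<open>orbit_design_parameter\<close>). One regular orbit suffices for \<open>m = 3\<close>; five of them and one more
  block suffice for \<open>m = 16\<close>.
\<close>

section \<open>Block counts in a 3-design\<close>

lemma card_subsets_between:
  assumes "finite W" "S \<subseteq> W" "card S \<le> t"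
  shows "card {T. S \<subseteq> T \<and> T \<subseteq> W \<and> card T = t} = (card W - card S) choose (t - card S)"
proof -
  have fin: "finite S" "finite (W - S)"
    using assms finite_subset by auto
  have "bij_betw (\<lambda>U. S \<union> U) {U. U \<subseteq> W - S \<and> card U = t - card S}
          {T. S \<subseteq> T \<and> T \<subseteq> W \<and> card T = t}"
  proof (rule bij_betw_byWitness[where f' = "\<lambda>T. T - S"])
    show "(\<lambda>U. S \<union> U) ` {U. U \<subseteq> W - S \<and> card U = t - card S}
        \<subseteq> {T. S \<subseteq> T \<and> T \<subseteq> W \<and> card T = t}"
    proof clarify
      fix U assume U: "U \<subseteq> W - S" "card U = t - card S"
      then have "card (S \<union> U) = card S + card U"
        using fin finite_subset by (intro card_Un_disjoint) blast+
      then show "S \<subseteq> S \<union> U \<and> S \<union> U \<subseteq> W \<and> card (S \<union> U) = t"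
        using U assms by auto
    qed
    show "(\<lambda>T. T - S) ` {T. S \<subseteq> T \<and> T \<subseteq> W \<and> card T = t}
        \<subseteq> {U. U \<subseteq> W - S \<and> card U = t - card S}"
      using fin by (auto simp: card_Diff_subset)
  qed auto
  then have "card {T. S \<subseteq> T \<and> T \<subseteq> W \<and> card T = t}
      = card {U. U \<subseteq> W - S \<and> card U = t - card S}"
    by (simp add: bij_betw_same_card)
  also have "\<dots> = card (W - S) choose (t - card S)"
    using fin by (simp add: n_subsets)
  also have "card (W - S) = card W - card S"
    using assms fin by (simp add: card_Diff_subset)
  finally show ?thesis .
qed

lemma design_finite_blocks: "is_3_design v k \<mu> (V, \<B>) \<Longrightarrow> finite \<B>"
  unfolding is_3_design_def by (auto intro: finite_subset[of _ "Pow V"])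

text \<open>Double counting of the pairs \<open>(T, B)\<close> with \<open>S \<subseteq> T \<subseteq> B\<close> and \<open>T\<close> of size 3. With \<open>S\<close> empty it gives the
  number of blocks, with \<open>S\<close> a singleton the number of blocks through a point.\<close>

lemma design_block_count:
  assumes design: "is_3_design v k \<mu> (V, \<B>)" and S: "S \<subseteq> V" "card S \<le> 3"
  shows "card {B \<in> \<B>. S \<subseteq> B} * ((k - card S) choose (3 - card S))
       = ((v - card S) choose (3 - card S)) * \<mu>"
proof -
  let ?BS = "{B \<in> \<B>. S \<subseteq> B}"
  let ?TS = "{T. S \<subseteq> T \<and> T \<subseteq> V \<and> card T = 3}"
  have V: "finite V" "card V = v" and B: "\<And>B. B \<in> \<B> \<Longrightarrow> B \<subseteq> V \<and> card B = k"
    and T: "\<And>T. T \<subseteq> V \<Longrightarrow> card T = 3 \<Longrightarrow> card {B \<in> \<B>. T \<subseteq> B} = \<mu>"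
    using design unfolding is_3_design_def by auto
  have fin: "finite ?BS" "finite ?TS"
    using V(1) design_finite_blocks[OF design] by auto
  have "(\<Sum>B \<in> ?BS. card {T \<in> ?TS. T \<subseteq> B}) = (\<Sum>T \<in> ?TS. card {B \<in> ?BS. T \<subseteq> B})"
    using sum.swap_restrict[OF fin, of "\<lambda>_ _. 1::nat" "\<lambda>B T. T \<subseteq> B"] by simp
  moreover have "card {T \<in> ?TS. T \<subseteq> B} = (k - card S) choose (3 - card S)" if "B \<in> ?BS" for B
  proof -
    have "{T \<in> ?TS. T \<subseteq> B} = {T. S \<subseteq> T \<and> T \<subseteq> B \<and> card T = 3}"
      using that B by blast
    moreover have "finite B" "S \<subseteq> B" "card B = k"
      using that B[of B] V(1) finite_subset[of B V] by auto
    ultimately show ?thesis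
      using card_subsets_between[of B S 3] S(2) by simp
  qed
  moreover have "card {B \<in> ?BS. T \<subseteq> B} = \<mu>" if "T \<in> ?TS" for T
  proof -
    have "{B \<in> ?BS. T \<subseteq> B} = {B \<in> \<B>. T \<subseteq> B}"
      using that by blast
    then show ?thesis using T that by simp
  qed
  moreover have "card ?TS = (v - card S) choose (3 - card S)"
    using card_subsets_between[OF V(1) S] V(2) by simp
  ultimately show ?thesis by simp
qed

section \<open>Many non-isomorphic unions of two designs\<close>

lemma design_image:
  assumes design: "is_3_design v k \<mu> (V, \<B>)" and f: "bij_betw f V W"
  shows "is_3_design v k \<mu> (W, (`) f ` \<B>)"
proof -
  have V: "finite V" "card V = v" and B: "\<And>B. B \<in> \<B> \<Longrightarrow> B \<subseteq> V \<and> card B = k"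
    and T: "\<And>T. T \<subseteq> V \<Longrightarrow> card T = 3 \<Longrightarrow> card {B \<in> \<B>. T \<subseteq> B} = \<mu>"
    using design unfolding is_3_design_def by auto
  have inj: "inj_on f V" and W: "f ` V = W"
    using f by (auto simp: bij_betw_def)
  have sub: "f ` S \<subseteq> f ` B \<longleftrightarrow> S \<subseteq> B" if "S \<subseteq> V" "B \<in> \<B>" for S B
  proof -
    have "f x \<in> f ` B \<longleftrightarrow> x \<in> B" if "x \<in> S" for x
      using that \<open>S \<subseteq> V\<close> B[OF \<open>B \<in> \<B>\<close>] by (intro inj_on_image_mem_iff[OF inj]) auto
    then show ?thesis
      by (simp only: image_subset_iff subset_iff) blast
  qed
  have "card {C \<in> (`) f ` \<B>. T \<subseteq> C} = \<mu>" if T': "T \<subseteq> W" "card T = 3" for T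
  proof -
    obtain S where S: "S \<subseteq> V" "T = f ` S"
      using T'(1) W by (metis subset_image_iff)
    then have "card S = 3"
      using T'(2) inj by (metis card_image inj_on_subset)
    have "{C \<in> (`) f ` \<B>. T \<subseteq> C} = (`) f ` {B \<in> \<B>. S \<subseteq> B}"
      using sub[OF S(1)] S(2) by blast
    also have "card \<dots> = card {B \<in> \<B>. S \<subseteq> B}"
      using inj_on_image_Pow[OF inj] B by (intro card_image) (auto elim!: inj_on_subset)
    finally show ?thesis
      using T[OF S(1) \<open>card S = 3\<close>] by simp
  qed
  moreover have "finite W" "card W = v"
    using V W inj by (auto simp: card_image)
  moreover have "f ` B \<subseteq> W \<and> card (f ` B) = k" if "B \<in> \<B>" for B
  proof -
    have "inj_on f B"
      using B[OF that] inj inj_on_subset by blast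
    then show ?thesis
      using B[OF that] W by (auto simp: card_image)
  qed
  ultimately show ?thesis
    unfolding is_3_design_def by auto
qed

lemma design_disjoint_union:
  assumes "is_3_design v k \<nu> (V, \<A>)" "is_3_design v k \<mu> (V, \<B>)" "\<A> \<inter> \<B> = {}"
  shows "is_3_design v k (\<nu> + \<mu>) (V, \<A> \<union> \<B>)"
proof -
  have fin: "finite \<A>" "finite \<B>"
    using assms design_finite_blocks by blast+
  have "card {B \<in> \<A> \<union> \<B>. T \<subseteq> B} = card {B \<in> \<A>. T \<subseteq> B} + card {B \<in> \<B>. T \<subseteq> B}" for T
    using fin assms(3) by (subst card_Un_disjoint[symmetric]) (auto intro: arg_cong[where f = card])
  then show ?thesis
    using assms(1,2) unfolding is_3_design_def by auto
qed

lemma isomorphic_refl: "isomorphic (V, \<B>) (V, \<B>)"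
  unfolding isomorphic_def by (auto intro!: exI[of _ id])

lemma isomorphic_sym:
  assumes "isomorphic (V, \<B>) (W, \<C>)" "\<And>B. B \<in> \<B> \<Longrightarrow> B \<subseteq> V"
  shows "isomorphic (W, \<C>) (V, \<B>)"
proof -
  obtain f where f: "bij_betw f V W" "(`) f ` \<B> = \<C>"
    using assms(1) unfolding isomorphic_def by auto
  have "the_inv_into V f ` f ` B = B" if "B \<in> \<B>" for B
    using assms(2)[OF that] f(1) unfolding image_image bij_betw_def
    by (intro trans[OF image_cong[OF refl] image_ident]) (auto intro!: the_inv_into_f_f)
  then have "(`) (the_inv_into V f) ` \<C> = \<B>"
    unfolding f(2)[symmetric] image_image by (simp cong: image_cong)
  then show ?thesis
    using bij_betw_the_inv_into[OF f(1)] unfolding isomorphic_def by auto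
qed

text \<open>A frame is a triple of distinct points with a list of \<open>s\<close> blocks through all three. In a
  3-design with parameter \<open>\<mu>\<close> every block of the list has only \<open>\<mu>\<close> candidates once the triple is
  chosen; this is what makes frames cheaper to count than arbitrary lists of blocks.\<close>

definition frame :: "'a set \<Rightarrow> 'a set set \<Rightarrow> nat \<Rightarrow> ('a \<times> 'a \<times> 'a) \<times> 'a set list \<Rightarrow> bool" where
  "frame V \<B> s = (\<lambda>((x, y, z), Bs). {x, y, z} \<subseteq> V \<and> card {x, y, z} = 3 \<and> length Bs = s \<and>
     set Bs \<subseteq> {B \<in> \<B>. {x, y, z} \<subseteq> B})"

definition separating :: "'a set \<Rightarrow> ('a \<times> 'a \<times> 'a) \<times> 'a set list \<Rightarrow> bool" where
  "separating V = (\<lambda>((x, y, z), Bs). \<forall>p \<in> V - {x, y, z}. \<forall>q \<in> V - {x, y, z}.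
     (\<forall>B \<in> set Bs. p \<in> B \<longleftrightarrow> q \<in> B) \<longrightarrow> p = q)"

definition frame_image :: "('a \<Rightarrow> 'b) \<Rightarrow> ('a \<times> 'a \<times> 'a) \<times> 'a set list \<Rightarrow> ('b \<times> 'b \<times> 'b) \<times> 'b set list" where
  "frame_image f = (\<lambda>((x, y, z), Bs). ((f x, f y, f z), map ((`) f) Bs))"

lemma frame_frame_image:
  assumes "frame V \<B> s F" "inj_on f V" "f ` V \<subseteq> W" "(`) f ` \<B> \<subseteq> \<C>"
  shows "frame W \<C> s (frame_image f F)"
proof -
  obtain x y z Bs where F: "F = ((x, y, z), Bs)"
    by (metis surj_pair)
  then have Bs: "{x, y, z} \<subseteq> V" "card {x, y, z} = 3" "length Bs = s"
      "set Bs \<subseteq> {B \<in> \<B>. {x, y, z} \<subseteq> B}"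
    using assms(1) by (simp_all only: frame_def prod.case)
  have "card (f ` {x, y, z}) = 3"
    using inj_on_subset[OF assms(2) Bs(1)] Bs(2) by (simp only: card_image)
  moreover have "f ` {x, y, z} \<subseteq> W"
    using Bs(1) assms(3) by blast
  moreover have "set (map ((`) f) Bs) \<subseteq> {C \<in> \<C>. f ` {x, y, z} \<subseteq> C}"
    using Bs(4) assms(4) by (simp only: set_map) blast
  ultimately show ?thesis
    using Bs(3) by (simp only: F frame_def frame_image_def prod.case length_map image_insert image_empty)
qed

lemma separating_frame_image:
  assumes "frame V \<B> s F" "separating V F" "bij_betw f V W" "\<And>B. B \<in> \<B> \<Longrightarrow> B \<subseteq> V"
  shows "separating W (frame_image f F)"
proof -
  obtain x y z Bs where F: "F = ((x, y, z), Bs)"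
    by (metis surj_pair)
  have inj: "inj_on f V" and W: "W = f ` V"
    using assms(3) by (auto simp: bij_betw_def)
  have mem: "f p \<in> f ` B \<longleftrightarrow> p \<in> B" if "p \<in> V" "B \<in> set Bs" for p B
    using inj that assms(1,4) by (intro inj_on_image_mem_iff[of f V]) (auto simp: F frame_def)
  have "p = q" if "p \<in> V - {x, y, z}" "q \<in> V - {x, y, z}" "\<forall>B \<in> set Bs. f p \<in> f ` B \<longleftrightarrow> f q \<in> f ` B" for p q
    using assms(2) that mem unfolding F separating_def prod.case by (metis DiffD1)
  then show ?thesis
    unfolding W by (auto simp: F separating_def frame_image_def)
qed

text \<open>A point outside the triple is recognised by the blocks of a separating frame that contain it,
  and a bijection carries this incidence pattern along. Hence a bijection is determined by what it
  does to the frame.\<close>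

lemma frame_image_eqD:
  assumes F: "frame V \<B> s F" "separating V F" "\<And>B. B \<in> \<B> \<Longrightarrow> B \<subseteq> V"
    and f: "bij_betw f V W" and g: "bij_betw g V W" and eq: "frame_image f F = frame_image g F"
    and p: "p \<in> V"
  shows "f p = g p"
proof -
  obtain x y z Bs where F': "F = ((x, y, z), Bs)"
    by (metis surj_pair)
  have xyz: "f x = g x" "f y = g y" "f z = g z" "{x, y, z} \<subseteq> V"
    and images: "\<And>B. B \<in> set Bs \<Longrightarrow> f ` B = g ` B" and Bs: "\<And>B. B \<in> set Bs \<Longrightarrow> B \<subseteq> V"
    using eq F by (auto simp: F' frame_image_def frame_def)
  have inj: "inj_on f V" "inj_on g V"
    using f g by (auto simp: bij_betw_def)
  obtain q where q: "q \<in> V" "g q = f p"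
    using f g p by (metis bij_betw_iff_bijections)
  show ?thesis
  proof (cases "p \<in> {x, y, z} \<or> q \<in> {x, y, z}")
    case True
    then show ?thesis
      using xyz q p inj by (metis empty_iff inj_onD insert_iff)
  next
    case False
    have "p \<in> B \<longleftrightarrow> q \<in> B" if "B \<in> set Bs" for B
      using inj_on_image_mem_iff[OF inj(1) p Bs[OF that]]
        inj_on_image_mem_iff[OF inj(2) q(1) Bs[OF that]] images[OF that] q(2) by simp
    moreover have "p \<in> V - {x, y, z}" "q \<in> V - {x, y, z}"
      using False p q(1) by simp_all
    ultimately have "p = q"
      using F(2) unfolding F' separating_def prod.case by blast
    then show ?thesis
      using q(2) by simp
  qed
qed

lemma finite_frames_card_le:
  assumes design: "is_3_design v k \<mu> (V, \<B>)"
  shows "finite (Collect (frame V \<B> s))" "card (Collect (frame V \<B> s)) \<le> v ^ 3 * \<mu> ^ s"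
proof -
  let ?T = "{(x, y, z). {x, y, z} \<subseteq> V \<and> card {x, y, z} = 3}"
  let ?L = "\<lambda>(x, y, z). {Bs. set Bs \<subseteq> {B \<in> \<B>. {x, y, z} \<subseteq> B} \<and> length Bs = s}"
  have V: "finite V" "card V = v"
    and \<mu>: "\<And>T. T \<subseteq> V \<Longrightarrow> card T = 3 \<Longrightarrow> card {B \<in> \<B>. T \<subseteq> B} = \<mu>"
    using design unfolding is_3_design_def by auto
  have "?T \<subseteq> V \<times> V \<times> V"
    by auto
  moreover have "card (V \<times> V \<times> V) = v ^ 3"
    using V by (simp add: card_cartesian_product power3_eq_cube)
  ultimately have T: "finite ?T" "card ?T \<le> v ^ 3"
    using V(1) finite_subset[of ?T "V \<times> V \<times> V"] card_mono[of "V \<times> V \<times> V" ?T] by auto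
  have L: "finite (?L t) \<and> card (?L t) = \<mu> ^ s" if t: "t \<in> ?T" for t
  proof -
    obtain x y z where xyz: "t = (x, y, z)"
      by (metis prod_cases3)
    have "finite {B \<in> \<B>. {x, y, z} \<subseteq> B}" "card {B \<in> \<B>. {x, y, z} \<subseteq> B} = \<mu>"
      using design_finite_blocks[OF design] \<mu>[of "{x, y, z}"] t unfolding xyz by simp_all
    then show ?thesis
      unfolding xyz by (simp add: card_lists_length_eq finite_lists_length_eq del: insert_subset)
  qed
  have eq: "Collect (frame V \<B> s) = (SIGMA t:?T. ?L t)"
    by (auto simp: frame_def)
  show "finite (Collect (frame V \<B> s))"
    unfolding eq using T L by (intro finite_SigmaI) auto
  have "card (Collect (frame V \<B> s)) = (\<Sum>t\<in>?T. card (?L t))"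
    unfolding eq using T L by (intro card_SigmaI) auto
  also have "\<dots> = card ?T * \<mu> ^ s"
    using L by simp
  finally show "card (Collect (frame V \<B> s)) \<le> v ^ 3 * \<mu> ^ s"
    using T(2) by simp
qed

text \<open>The permutation moves the second family only: composing both parts with the same permutation
  would give an isomorphic result.\<close>

definition merge :: "'a set set \<Rightarrow> 'a set set \<Rightarrow> ('a \<Rightarrow> 'a) \<Rightarrow> 'a set set" where
  "merge \<A> \<B> \<rho> = \<A> \<union> (`) \<rho> ` \<B>"

text \<open>If \<open>f\<close> maps the union onto \<open>\<E>\<close>, then \<open>f\<close> sends a frame of \<open>\<A>\<close> and \<open>f \<circ> \<rho>\<close> sends a frame of \<open>\<B>\<close> to
  frames of \<open>\<E>\<close>. The two image frames determine \<open>f\<close> and \<open>f \<circ> \<rho>\<close>, hence \<open>\<rho>\<close>.\<close>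

lemma card_merges_isomorphic_le:
  assumes A: "\<And>B. B \<in> \<A> \<Longrightarrow> B \<subseteq> V" "frame V \<A> s F" "separating V F"
    and B: "\<And>B. B \<in> \<B> \<Longrightarrow> B \<subseteq> V" "frame V \<B> t G" "separating V G"
    and E: "is_3_design v k \<mu> (V, \<E>)"
  shows "card {\<rho>. \<rho> permutes V \<and> isomorphic (V, merge \<A> \<B> \<rho>) (V, \<E>)}
    \<le> (v ^ 3 * \<mu> ^ s) * (v ^ 3 * \<mu> ^ t)"
proof -
  let ?X = "{\<rho>. \<rho> permutes V \<and> isomorphic (V, merge \<A> \<B> \<rho>) (V, \<E>)}"
  have "\<forall>\<rho>\<in>?X. \<exists>f. bij_betw f V V \<and> (`) f ` merge \<A> \<B> \<rho> = \<E>"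
    unfolding isomorphic_def by auto
  from bchoice[OF this] obtain f
    where "\<forall>\<rho>\<in>?X. bij_betw (f \<rho>) V V \<and> (`) (f \<rho>) ` merge \<A> \<B> \<rho> = \<E>"
    ..
  then have f: "\<And>\<rho>. \<rho> \<in> ?X \<Longrightarrow> bij_betw (f \<rho>) V V \<and> (`) (f \<rho>) ` merge \<A> \<B> \<rho> = \<E>"
    by (rule bspec)
  define code where "code \<rho> = (frame_image (f \<rho>) F, frame_image (f \<rho> \<circ> \<rho>) G)" for \<rho>
  have comp: "bij_betw (f \<rho> \<circ> \<rho>) V V" if "\<rho> \<in> ?X" for \<rho>
    using f[OF that] that by (auto intro: bij_betw_trans permutes_imp_bij)
  have "inj_on code ?X"
  proof (rule inj_onI)
    fix \<rho> \<sigma>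
    assume X: "\<rho> \<in> ?X" "\<sigma> \<in> ?X" and eq: "code \<rho> = code \<sigma>"
    have 1: "f \<rho> p = f \<sigma> p" if "p \<in> V" for p
      using frame_image_eqD[OF A(2,3,1), of "f \<rho>" V "f \<sigma>" p] f X eq that by (auto simp: code_def)
    have 2: "f \<rho> (\<rho> p) = f \<sigma> (\<sigma> p)" if "p \<in> V" for p
      using frame_image_eqD[OF B(2,3,1) comp[OF X(1)] comp[OF X(2)] _ that] eq
      by (auto simp: code_def)
    have perm: "\<rho> permutes V" "\<sigma> permutes V"
      using X by auto
    show "\<rho> = \<sigma>"
    proof
      fix p
      show "\<rho> p = \<sigma> p"
      proof (cases "p \<in> V")
        case True
        then have in_V: "\<rho> p \<in> V" "\<sigma> p \<in> V"
          using perm by (auto simp: permutes_in_image)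
        then have "f \<rho> (\<rho> p) = f \<rho> (\<sigma> p)"
          using 1 2[OF True] by simp
        then show ?thesis
          using f[OF X(1)] in_V by (auto simp: bij_betw_def inj_on_def)
      next
        case False
        then show ?thesis
          using perm by (simp add: permutes_def)
      qed
    qed
  qed
  moreover have "code ` ?X \<subseteq> Collect (frame V \<E> s) \<times> Collect (frame V \<E> t)"
  proof (rule image_subsetI)
    fix \<rho>
    assume X: "\<rho> \<in> ?X"
    have "(`) (f \<rho> \<circ> \<rho>) ` \<B> = (`) (f \<rho>) ` (`) \<rho> ` \<B>"
      by (simp add: image_image comp_def)
    then have "(`) (f \<rho>) ` \<A> \<subseteq> \<E>" "(`) (f \<rho> \<circ> \<rho>) ` \<B> \<subseteq> \<E>"
      using f[OF X] unfolding merge_def by auto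
    then show "code \<rho> \<in> Collect (frame V \<E> s) \<times> Collect (frame V \<E> t)"
      unfolding code_def using frame_frame_image[OF A(2), of "f \<rho>"] f[OF X]
        frame_frame_image[OF B(2), of "f \<rho> \<circ> \<rho>"] comp[OF X] by (auto simp: bij_betw_def)
  qed
  ultimately have "card ?X \<le> card (Collect (frame V \<E> s) \<times> Collect (frame V \<E> t))"
    using finite_frames_card_le(1)[OF E] by (intro card_inj_on_le) auto
  also have "\<dots> \<le> (v ^ 3 * \<mu> ^ s) * (v ^ 3 * \<mu> ^ t)"
    unfolding card_cartesian_product by (intro mult_mono finite_frames_card_le(2)[OF E]) auto
  finally show ?thesis .
qed

text \<open>Such a permutation splits into a bijection from \<open>B\<close> to \<open>A\<close> and one between the complements.\<close>

lemma card_permutes_image_eq_le: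
  assumes V: "finite V" and A: "A \<subseteq> V" and B: "B \<subseteq> V" "card B = card A"
  shows "card {\<rho>. \<rho> permutes V \<and> \<rho> ` B = A} \<le> fact (card A) * fact (card V - card A)"
proof -
  let ?inj = "\<lambda>S T. {f \<in> S \<rightarrow>\<^sub>E T. inj_on f S}"
  let ?r = "\<lambda>\<rho>. (restrict \<rho> B, restrict \<rho> (V - B))"
  have fin: "finite A" "finite B" "finite (V - A)" "finite (V - B)"
    using assms finite_subset by auto
  have "inj_on ?r {\<rho>. \<rho> permutes V \<and> \<rho> ` B = A}"
  proof (rule inj_onI, clarify)
    fix \<rho> \<sigma>
    assume perm: "\<rho> permutes V" "\<sigma> permutes V"
      and eq: "restrict \<rho> B = restrict \<sigma> B" "restrict \<rho> (V - B) = restrict \<sigma> (V - B)"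
    show "\<rho> = \<sigma>"
    proof
      fix p
      show "\<rho> p = \<sigma> p"
        using fun_cong[OF eq(1), of p] fun_cong[OF eq(2), of p] perm
        by (cases "p \<in> B"; cases "p \<in> V") (auto simp: permutes_def)
    qed
  qed
  moreover have "?r ` {\<rho>. \<rho> permutes V \<and> \<rho> ` B = A} \<subseteq> ?inj B A \<times> ?inj (V - B) (V - A)"
  proof (rule image_subsetI)
    fix \<rho>
    assume "\<rho> \<in> {\<rho>. \<rho> permutes V \<and> \<rho> ` B = A}"
    then have \<rho>: "inj \<rho>" "\<rho> ` V = V" "\<rho> ` B = A"
      by (auto simp: permutes_inj permutes_image)
    then have "\<rho> ` (V - B) = V - A"
      by (simp add: image_set_diff)
    then show "?r \<rho> \<in> ?inj B A \<times> ?inj (V - B) (V - A)"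
      using \<rho> by (auto simp: inj_on_def inj_def)
  qed
  moreover have "card (?inj S T) = fact (card T)" "finite (?inj S T)"
    if "finite S" "finite T" "card S = card T" for S T :: "'a set"
    using that card_inj_on_subset_funcset[of S T S] by (auto simp: fact_prod_rev intro!: finite_subset[OF _ finite_PiE[of S "\<lambda>_. T"]])
  moreover have "card (V - A) = card V - card A" "card (V - B) = card (V - A)"
    using assms fin by (auto simp: card_Diff_subset)
  ultimately show ?thesis
    using card_inj_on_le[of ?r "{\<rho>. \<rho> permutes V \<and> \<rho> ` B = A}" "?inj B A \<times> ?inj (V - B) (V - A)"] fin B(2)
    by (simp add: card_cartesian_product)
qed

text \<open>A union bound over the pairs of blocks that may be made to coincide.\<close>

lemma card_overlapping_le:
  assumes A: "is_3_design v k \<nu> (V, \<A>)" and B: "is_3_design v k \<mu> (V, \<B>)"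
  shows "card {\<rho>. \<rho> permutes V \<and> \<A> \<inter> (`) \<rho> ` \<B> \<noteq> {}}
    \<le> card \<A> * card \<B> * (fact k * fact (v - k))"
proof -
  have V: "finite V" "card V = v" and blocks: "\<And>B. B \<in> \<A> \<union> \<B> \<Longrightarrow> B \<subseteq> V \<and> card B = k"
    using A B unfolding is_3_design_def by auto
  have fin: "finite (\<A> \<times> \<B>)"
    using A B design_finite_blocks by blast
  have "{\<rho>. \<rho> permutes V \<and> \<A> \<inter> (`) \<rho> ` \<B> \<noteq> {}}
      \<subseteq> (\<Union>(C, D)\<in>\<A> \<times> \<B>. {\<rho>. \<rho> permutes V \<and> \<rho> ` D = C})"
    by blast
  moreover have "finite (\<Union>(C, D)\<in>\<A> \<times> \<B>. {\<rho>. \<rho> permutes V \<and> \<rho> ` D = C})"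
    using V(1) by (auto intro!: finite_subset[OF _ finite_permutations[of V]] fin)
  ultimately have "card {\<rho>. \<rho> permutes V \<and> \<A> \<inter> (`) \<rho> ` \<B> \<noteq> {}}
      \<le> card (\<Union>(C, D)\<in>\<A> \<times> \<B>. {\<rho>. \<rho> permutes V \<and> \<rho> ` D = C})"
    by (intro card_mono)
  also have "\<dots> \<le> (\<Sum>(C, D)\<in>\<A> \<times> \<B>. card {\<rho>. \<rho> permutes V \<and> \<rho> ` D = C})"
    using card_UN_le[OF fin, of "\<lambda>(C, D). {\<rho>. \<rho> permutes V \<and> \<rho> ` D = C}"]
    by (simp add: case_prod_unfold)
  also have "\<dots> \<le> (\<Sum>(C, D)\<in>\<A> \<times> \<B>. fact k * fact (v - k))"
  proof (rule sum_mono, clarify)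
    fix C D
    assume "C \<in> \<A>" "D \<in> \<B>"
    then show "card {\<rho>. \<rho> permutes V \<and> \<rho> ` D = C} \<le> fact k * fact (v - k)"
      using card_permutes_image_eq_le[OF V(1), of C D] blocks[of C] blocks[of D] V(2) by simp
  qed
  also have "\<dots> = card \<A> * card \<B> * (fact k * fact (v - k))"
    by (simp add: card_cartesian_product case_prod_unfold)
  finally show ?thesis .
qed

text \<open>A maximal family of pairwise non-isomorphic unions meets every isomorphism class of unions. Each
  class accounts for a bounded number of permutations, so a small family would leave some
  permutations without a class.\<close>

lemma many_nonisomorphic_merges:
  fixes V :: "'a set"
  assumes A: "is_3_design v k \<nu> (V, \<A>)" "frame V \<A> s F" "separating V F"
    and B: "is_3_design v k \<mu> (V, \<B>)" "frame V \<B> t G" "separating V G"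
    and count: "m * ((v ^ 3 * (\<nu> + \<mu>) ^ s) * (v ^ 3 * (\<nu> + \<mu>) ^ t))
      + card \<A> * card \<B> * (fact k * fact (v - k)) < fact v"
  shows "\<exists>\<D> :: 'a incidence_structure set. card \<D> > m \<and> (\<forall>D\<in>\<D>. is_3_design v k (\<nu> + \<mu>) D) \<and>
    pairwise (\<lambda>D E. \<not> isomorphic D E) \<D>"
proof -
  let ?N = "(v ^ 3 * (\<nu> + \<mu>) ^ s) * (v ^ 3 * (\<nu> + \<mu>) ^ t)"
  have V: "finite V" "card V = v" and blocks: "\<And>B. B \<in> \<A> \<Longrightarrow> B \<subseteq> V" "\<And>B. B \<in> \<B> \<Longrightarrow> B \<subseteq> V"
    using A B unfolding is_3_design_def by auto
  define good where "good = {\<rho>. \<rho> permutes V \<and> \<A> \<inter> (`) \<rho> ` \<B> = {}}"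
  have fin: "finite good"
    unfolding good_def using finite_permutations[OF V(1)] by (rule rev_finite_subset) auto
  have "fact v = card {\<rho>. \<rho> permutes V}"
    using card_permutations[OF V(2,1)] by simp
  also have "{\<rho>. \<rho> permutes V} = good \<union> {\<rho>. \<rho> permutes V \<and> \<A> \<inter> (`) \<rho> ` \<B> \<noteq> {}}"
    unfolding good_def by auto
  also have "card \<dots> \<le> card good + card \<A> * card \<B> * (fact k * fact (v - k))"
    using card_Un_le card_overlapping_le[OF A(1) B(1)] by (rule order_trans[OF _ add_left_mono])
  finally have many: "m * ?N < card good"
    using count by simp
  define merged where "merged = (\<lambda>\<rho>. (V, merge \<A> \<B> \<rho>)) ` good"
  have design: "is_3_design v k (\<nu> + \<mu>) D" if "D \<in> merged" for D
    using that A(1) B(1) unfolding merged_def good_def merge_def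
    by (auto intro!: design_disjoint_union design_image permutes_imp_bij)
  have finite_merged: "finite merged"
    unfolding merged_def using fin by simp
  \<comment> \<open>Only finitely many families exist, so one of largest size can be chosen.\<close>
  define \<M> where "\<M> = {M. M \<subseteq> merged \<and> pairwise (\<lambda>D E. \<not> isomorphic D E) M}"
  have "finite \<M>" "{} \<in> \<M>"
    unfolding \<M>_def using finite_merged by auto
  then have "Max (card ` \<M>) \<in> card ` \<M>"
    by (intro Max_in) auto
  then obtain M where M: "M \<in> \<M>" and "card M = Max (card ` \<M>)"
    by auto
  then have max: "card M' \<le> card M" if "M' \<in> \<M>" for M'
    using that \<open>finite \<M>\<close> by simp
  have finM: "finite M"
    using M finite_merged finite_subset unfolding \<M>_def by blast
  have "good \<subseteq> (\<Union>D\<in>M. {\<rho>. \<rho> permutes V \<and> isomorphic (V, merge \<A> \<B> \<rho>) D})"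
  proof
    fix \<rho>
    assume \<rho>: "\<rho> \<in> good"
    let ?D = "(V, merge \<A> \<B> \<rho>)"
    have D: "?D \<in> merged"
      using \<rho> unfolding merged_def by blast
    have "\<exists>E\<in>M. isomorphic ?D E"
    proof (rule ccontr)
      assume none: "\<not> ?thesis"
      have "\<not> isomorphic E ?D" if "E \<in> M" for E
      proof
        assume iso: "isomorphic E ?D"
        have "E \<in> merged"
          using M that unfolding \<M>_def by blast
        then obtain \<E> where E: "E = (V, \<E>)"
          unfolding merged_def by blast
        then have "\<And>B. B \<in> \<E> \<Longrightarrow> B \<subseteq> V"
          using design[OF \<open>E \<in> merged\<close>] unfolding is_3_design_def by auto
        then have "isomorphic ?D E"
          using iso isomorphic_sym unfolding E by blast
        then show False
          using none that by blast
      qed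
      then have "insert ?D M \<in> \<M>"
        using M D none unfolding \<M>_def by (auto simp: pairwise_insert)
      moreover have "?D \<notin> M"
        using none isomorphic_refl by blast
      ultimately show False
        using max[of "insert ?D M"] finM by simp
    qed
    then show "\<rho> \<in> (\<Union>D\<in>M. {\<rho>. \<rho> permutes V \<and> isomorphic (V, merge \<A> \<B> \<rho>) D})"
      using \<rho> unfolding good_def by blast
  qed
  then have "card good \<le> card (\<Union>D\<in>M. {\<rho>. \<rho> permutes V \<and> isomorphic (V, merge \<A> \<B> \<rho>) D})"
    using finM V(1) by (intro card_mono) (auto intro!: finite_subset[OF _ finite_permutations[of V]])
  also have "\<dots> \<le> (\<Sum>D\<in>M. card {\<rho>. \<rho> permutes V \<and> isomorphic (V, merge \<A> \<B> \<rho>) D})"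
    by (rule card_UN_le[OF finM])
  also have "\<dots> \<le> (\<Sum>D\<in>M. ?N)"
  proof (rule sum_mono)
    fix D
    assume "D \<in> M"
    then have "D \<in> merged"
      using M unfolding \<M>_def by blast
    then obtain \<E> where "D = (V, \<E>)"
      unfolding merged_def by blast
    then show "card {\<rho>. \<rho> permutes V \<and> isomorphic (V, merge \<A> \<B> \<rho>) D} \<le> ?N"
      using card_merges_isomorphic_le[OF blocks(1) A(2,3) blocks(2) B(2,3)] design[OF \<open>D \<in> merged\<close>]
      by blast
  qed
  also have "\<dots> = card M * ?N"
    by simp
  finally have "m * ?N < card M * ?N"
    by (rule less_le_trans[OF many])
  then have "m < card M"
    by (simp only: mult_less_cancel2)
  then show ?thesis
    using M design unfolding \<M>_def by (intro exI[of _ M]) blast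
qed

section \<open>Squares in a finite field of order 3 modulo 4\<close>

definition nonzero_squares :: "'a::field set" where
  "nonzero_squares = {x\<^sup>2 | x. x \<noteq> 0}"

lemma nonzero_squaresI: "x \<noteq> 0 \<Longrightarrow> x\<^sup>2 \<in> nonzero_squares"
  unfolding nonzero_squares_def by blast

lemma zero_not_nonzero_square [simp]: "0 \<notin> nonzero_squares"
  unfolding nonzero_squares_def by auto

lemma one_nonzero_square [simp]: "1 \<in> nonzero_squares"
  using nonzero_squaresI[of 1] by simp

lemma nonzero_squares_mult: "a \<in> nonzero_squares \<Longrightarrow> b \<in> nonzero_squares \<Longrightarrow> a * b \<in> nonzero_squares"
  unfolding nonzero_squares_def by (auto simp flip: power_mult_distrib)

lemma nonzero_squares_inverse: "a \<in> nonzero_squares \<Longrightarrow> inverse a \<in> nonzero_squares"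
  unfolding nonzero_squares_def by (auto simp flip: power_inverse)

lemma nonzero_squares_divide: "a \<in> nonzero_squares \<Longrightarrow> b \<in> nonzero_squares \<Longrightarrow> a / b \<in> nonzero_squares"
  by (simp add: divide_inverse nonzero_squares_mult nonzero_squares_inverse)

context
  assumes card_mod_4: "CARD('a::finite_field) mod 4 = 3"
begin

text \<open>With \<open>q = 4 k + 3\<close>, Fermat's theorem gives \<open>x\<^sup>2\<^sup>k\<^sup>+\<^sup>1 = \<plusminus>1\<close>, so \<open>\<plusminus>x\<close> is the square of \<open>x\<^sup>k\<^sup>+\<^sup>1\<close>.\<close>

lemma square_or_neg_square:
  fixes x :: 'a
  assumes "x \<noteq> 0"
  shows "x \<in> nonzero_squares \<or> -x \<in> nonzero_squares"
proof -
  obtain k where k: "CARD('a) = 4 * k + 3"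
    using card_mod_4 by (metis mult_div_mod_eq)
  have "CARD('a) = Suc (4 * k + 2)"
    using k by simp
  then have "x * x ^ (4 * k + 2) = x * 1"
    using finite_field_power_card_eq_same[of x] by (simp only: power_Suc mult_1_right)
  then have "x ^ (4 * k + 2) = 1"
    using assms by simp
  then have "(x ^ (2 * k + 1))\<^sup>2 = 1"
    by (simp only: power_mult[symmetric]) (simp add: algebra_simps)
  then have "x ^ (2 * k + 1) = 1 \<or> x ^ (2 * k + 1) = -1"
    by (simp add: power2_eq_1_iff)
  moreover have "(x ^ (k + 1))\<^sup>2 = x * x ^ (2 * k + 1)"
    by (simp only: power_mult[symmetric] power_Suc[symmetric]) (simp add: algebra_simps)
  ultimately have "x = (x ^ (k + 1))\<^sup>2 \<or> -x = (x ^ (k + 1))\<^sup>2"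
    by auto
  then show ?thesis
    using nonzero_squaresI[of "x ^ (k + 1)"] assms by fastforce
qed

text \<open>Otherwise \<open>-1 = y\<^sup>2\<close> for some \<open>y\<close>, and as \<open>(q - 1) / 2\<close> is odd this contradicts \<open>y\<^sup>q = y\<close>.\<close>

lemma neg_not_square:
  fixes x :: 'a
  assumes "x \<in> nonzero_squares"
  shows "-x \<notin> nonzero_squares"
proof
  assume "-x \<in> nonzero_squares"
  then have "-1 \<in> (nonzero_squares :: 'a set)"
    using nonzero_squares_divide[OF \<open>-x \<in> nonzero_squares\<close> assms] assms
    by (cases "x = 0") auto
  then obtain y :: 'a where y: "y \<noteq> 0" "y\<^sup>2 = -1"
    unfolding nonzero_squares_def by auto
  obtain k where k: "CARD('a) = 4 * k + 3"
    using card_mod_4 by (metis mult_div_mod_eq)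
  then have "CARD('a) = Suc (2 * (2 * k + 1))"
    by simp
  then have "y = y * (y\<^sup>2) ^ (2 * k + 1)"
    using finite_field_power_card_eq_same[of y] by (simp only: power_Suc power_mult)
  also have "\<dots> = -y"
    by (simp add: y(2))
  finally have "y + y = 0"
    by (simp only: eq_neg_iff_add_eq_0)
  then have "(2::'a) = 0"
    using y(1) by (metis mult_2 mult_eq_0_iff)
  \<comment> \<open>Summing over all translates shows that the odd number \<open>q\<close> vanishes in the field, so 2 does not.\<close>
  have "(\<Sum>x\<in>UNIV. x + 1) = (\<Sum>x\<in>UNIV. x :: 'a)"
    by (rule sum.reindex_bij_witness[of _ "\<lambda>x. x - 1" "\<lambda>x. x + 1"]) auto
  then have "of_nat (CARD('a)) = (0::'a)"
    by (simp add: sum.distrib)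
  then have "of_nat (2 * (2 * k + 1) + 1) = (0::'a)"
    unfolding k by (simp add: algebra_simps)
  then have "2 * (of_nat (2 * k + 1)) + 1 = (0::'a)"
    by simp
  then show False
    by (simp add: \<open>(2::'a) = 0\<close>)
qed

lemma square_eq_imp_eq:
  fixes e f :: 'a
  assumes "e \<in> nonzero_squares" "f \<in> nonzero_squares" "e\<^sup>2 = f\<^sup>2"
  shows "e = f"
  using assms neg_not_square by (auto simp: power2_eq_iff)

lemma card_nonzero_squares: "2 * card (nonzero_squares :: 'a set) + 1 = CARD('a)"
proof -
  let ?S = "nonzero_squares :: 'a set"
  have "UNIV = insert 0 (?S \<union> uminus ` ?S)"
    using square_or_neg_square by force
  then have "CARD('a) = card (insert 0 (?S \<union> uminus ` ?S))"
    by simp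
  also have "\<dots> = Suc (card (?S \<union> uminus ` ?S))"
    by (subst card_insert_disjoint) auto
  also have "card (?S \<union> uminus ` ?S) = card ?S + card (uminus ` ?S)"
    using neg_not_square by (subst card_Un_disjoint) auto
  also have "card (uminus ` ?S) = card ?S"
    by (simp add: card_image)
  finally show ?thesis by simp
qed

end

section \<open>The action of PSL(2, q) on the projective line\<close>

text \<open>The point at infinity of the projective line is \<open>None\<close>.\<close>

definition aff :: "'a::field \<Rightarrow> 'a \<Rightarrow> 'a option \<Rightarrow> 'a option" where
  "aff e a = map_option (\<lambda>x. e * x + a)"

definition neg_inv :: "'a::field option \<Rightarrow> 'a option" where
  "neg_inv p = (case p of None \<Rightarrow> Some 0 | Some x \<Rightarrow> if x = 0 then None else Some (- 1 / x))"

text \<open>These are the maps \<open>x \<mapsto> (a x + b) / (c x + d)\<close> whose determinant is a nonzero square, listed by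
  Bruhat normal form: \<open>c = 0\<close> in the first set and \<open>c \<noteq> 0\<close> in the second, the big cell. In this form the bound
  on their number (\<open>card_PSL_le\<close>) is immediate, and closure under composition is what needs proof.\<close>

definition PSL :: "('a::field option \<Rightarrow> 'a option) set" where
  "PSL = {aff e a | e a. e \<in> nonzero_squares} \<union>
         {aff e a \<circ> neg_inv \<circ> aff 1 d | e a d. e \<in> nonzero_squares}"

lemma aff_simps [simp]: "aff e a None = None" "aff e a (Some x) = Some (e * x + a)"
  by (simp_all add: aff_def)

lemma neg_inv_simps [simp]: "neg_inv None = Some 0" "neg_inv (Some 0) = None"
  "x \<noteq> 0 \<Longrightarrow> neg_inv (Some x) = Some (- 1 / x)"
  by (simp_all add: neg_inv_def)

lemma aff_1_0: "aff 1 0 = id"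
  by (simp add: aff_def fun_eq_iff option.map_ident)

lemma aff_comp: "aff e a \<circ> aff f b = aff (e * f) (e * b + a)"
  by (rule ext, rename_tac p, case_tac p) (simp_all add: algebra_simps)

lemma neg_inv_neg_inv: "neg_inv (neg_inv p) = p"
  by (cases p) (auto simp: neg_inv_def)

lemma neg_inv_aff: "e \<noteq> 0 \<Longrightarrow> neg_inv \<circ> aff e a = aff (1 / e) 0 \<circ> neg_inv \<circ> aff 1 (a / e)"
  apply (rule ext, rename_tac p, case_tac p)
   apply (simp_all add: neg_inv_def)
  apply (auto simp: field_simps add_eq_0_iff)
  done

text \<open>The rewriting step that brings a product of two elements of the big cell back to normal form.\<close>

lemma neg_inv_aff_neg_inv:
  assumes "e \<noteq> 0" "a \<noteq> 0"
  shows "neg_inv \<circ> aff e a \<circ> neg_inv = aff (e / a\<^sup>2) (- 1 / a) \<circ> neg_inv \<circ> aff 1 (- e / a)"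
proof
  fix p
  show "(neg_inv \<circ> aff e a \<circ> neg_inv) p = (aff (e / a\<^sup>2) (- 1 / a) \<circ> neg_inv \<circ> aff 1 (- e / a)) p"
  proof (cases p)
    case None
    then show ?thesis using assms by simp
  next
    case (Some x)
    consider "x = 0" | "x \<noteq> 0" "a * x = e" | "x \<noteq> 0" "a * x \<noteq> e" by blast
    then show ?thesis
    proof cases
      case 1
      then show ?thesis using Some assms by (simp add: power2_eq_square)
    next
      case 2
      then have "x = e / a" "a = e / x" using assms by (auto simp: field_simps)
      then show ?thesis using Some assms 2 by (simp add: neg_inv_def)
    next
      case 3
      then have ne: "x - e / a \<noteq> 0" "a - e / x \<noteq> 0" using assms by (auto simp: field_simps)
      have "- 1 / (a - e / x) = e / a\<^sup>2 * (- 1 / (x - e / a)) - 1 / a"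
        using 3 ne assms by (simp add: divide_simps power2_eq_square)
      then show ?thesis using Some 3 ne by (simp add: neg_inv_def)
    qed
  qed
qed

lemma bij_aff: "e \<noteq> 0 \<Longrightarrow> bij (aff e a)"
  by (rule o_bij[where g = "aff (1 / e) (- a / e)"]) (simp_all add: aff_comp aff_1_0)

lemma bij_neg_inv: "bij neg_inv"
  by (rule involuntory_imp_bij) (rule neg_inv_neg_inv)

lemma aff_in_PSL: "e \<in> nonzero_squares \<Longrightarrow> aff e a \<in> PSL"
  unfolding PSL_def by blast

lemma big_cell_in_PSL: "e \<in> nonzero_squares \<Longrightarrow> aff e a \<circ> neg_inv \<circ> aff 1 d \<in> PSL"
  unfolding PSL_def by blast

lemma bij_PSL:
  fixes g :: "'a::field option \<Rightarrow> 'a option"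
  shows "g \<in> PSL \<Longrightarrow> bij g"
  unfolding PSL_def using zero_not_nonzero_square[where 'a = 'a]
  by (auto intro!: bij_comp bij_aff bij_neg_inv)

lemma aff_comp_PSL:
  assumes "e \<in> nonzero_squares" "g \<in> PSL"
  shows "aff e a \<circ> g \<in> PSL"
proof -
  from assms(2) consider f b where "f \<in> nonzero_squares" "g = aff f b"
    | f b d where "f \<in> nonzero_squares" "g = aff f b \<circ> neg_inv \<circ> aff 1 d"
    unfolding PSL_def by blast
  then show ?thesis
  proof cases
    case 1
    then show ?thesis
      using assms(1) by (simp add: aff_comp aff_in_PSL nonzero_squares_mult)
  next
    case 2
    have "aff e a \<circ> g = (aff e a \<circ> aff f b) \<circ> neg_inv \<circ> aff 1 d"
      by (simp add: 2 comp_assoc)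
    then show ?thesis
      using 2 assms(1) by (simp only: aff_comp big_cell_in_PSL nonzero_squares_mult)
  qed
qed

text \<open>Left multiplication by the inversion either moves between the two cells or, for an element of
  the big cell that sends infinity to a nonzero point, stays in the big cell.\<close>

lemma neg_inv_comp_PSL:
  fixes g :: "'a::field option \<Rightarrow> 'a option"
  assumes "g \<in> PSL"
  shows "neg_inv \<circ> g \<in> PSL"
proof -
  from assms consider e a where "e \<in> nonzero_squares" "g = aff e a"
    | e d where "e \<in> nonzero_squares" "g = aff e 0 \<circ> neg_inv \<circ> aff 1 d"
    | e a d where "e \<in> nonzero_squares" "a \<noteq> 0" "g = aff e a \<circ> neg_inv \<circ> aff 1 d"
    unfolding PSL_def by (smt (verit) Un_iff mem_Collect_eq)
  then show ?thesis
  proof cases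
    case 1
    then have "e \<noteq> 0" by auto
    have "1 / e \<in> nonzero_squares"
      using 1 by (intro nonzero_squares_divide) auto
    then show ?thesis
      unfolding 1 neg_inv_aff[OF \<open>e \<noteq> 0\<close>] by (rule big_cell_in_PSL)
  next
    case 2
    then have "e \<noteq> 0" by auto
    have "neg_inv \<circ> g = aff (1 / e) 0 \<circ> (neg_inv \<circ> neg_inv) \<circ> aff 1 d"
      using neg_inv_aff[OF \<open>e \<noteq> 0\<close>, of 0] by (simp add: 2 aff_1_0 comp_assoc[symmetric])
    also have "neg_inv \<circ> neg_inv = (id :: 'a option \<Rightarrow> _)"
      by (simp add: fun_eq_iff neg_inv_neg_inv)
    finally have "neg_inv \<circ> g = aff (1 / e) 0 \<circ> aff 1 d"
      by (simp only: comp_id)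
    then show ?thesis
      using 2 by (simp add: aff_comp aff_in_PSL nonzero_squares_divide)
  next
    case 3
    then have "e \<noteq> 0" by auto
    have "e / a\<^sup>2 \<in> nonzero_squares"
      using 3 by (simp add: nonzero_squares_divide nonzero_squaresI)
    moreover have "neg_inv \<circ> g = aff (e / a\<^sup>2) (- 1 / a) \<circ> neg_inv \<circ> (aff 1 (- e / a) \<circ> aff 1 d)"
      unfolding 3 comp_assoc[symmetric] neg_inv_aff_neg_inv[OF \<open>e \<noteq> 0\<close> \<open>a \<noteq> 0\<close>] ..
    ultimately show ?thesis
      by (simp only: aff_comp mult_1 big_cell_in_PSL)
  qed
qed

lemma PSL_comp:
  assumes "g \<in> PSL" "h \<in> PSL"
  shows "g \<circ> h \<in> PSL"
proof -
  from assms(1) consider e a where "e \<in> nonzero_squares" "g = aff e a"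
    | e a d where "e \<in> nonzero_squares" "g = aff e a \<circ> neg_inv \<circ> aff 1 d"
    unfolding PSL_def by blast
  then show ?thesis
  proof cases
    case 1
    then show ?thesis using assms(2) by (simp add: aff_comp_PSL)
  next
    case 2
    have "g \<circ> h = aff e a \<circ> (neg_inv \<circ> (aff 1 d \<circ> h))"
      by (simp add: 2 comp_assoc)
    then show ?thesis
      using 2 assms(2) by (simp add: aff_comp_PSL neg_inv_comp_PSL)
  qed
qed

lemma card_PSL_le:
  "card (PSL :: ('a::{field,finite} option \<Rightarrow> 'a option) set) \<le>
    card (nonzero_squares :: 'a set) * CARD('a) * (CARD('a) + 1)"
proof -
  let ?S = "nonzero_squares :: 'a set"
  let ?A = "(\<lambda>(e, a). aff e a) ` (?S \<times> UNIV)"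
  let ?B = "(\<lambda>(e, a, d). aff e a \<circ> neg_inv \<circ> aff 1 d) ` (?S \<times> UNIV \<times> UNIV)"
  have "PSL = ?A \<union> ?B"
    unfolding PSL_def by (auto simp: image_iff Bex_def) metis+
  moreover have "card ?A \<le> card ?S * CARD('a)"
    using card_image_le[of "?S \<times> UNIV" "\<lambda>(e, a). aff e a"] by (simp add: card_cartesian_product)
  moreover have "card ?B \<le> card ?S * (CARD('a) * CARD('a))"
    using card_image_le[of "?S \<times> UNIV \<times> UNIV" "\<lambda>(e, a, d). aff e a \<circ> neg_inv \<circ> aff 1 d"]
    by (simp add: card_cartesian_product)
  ultimately show ?thesis
    using card_Un_le[of ?A ?B] by (simp add: algebra_simps)
qed

section \<open>Orbits of blocks\<close>

definition orbit :: "'a::field option set \<Rightarrow> 'a option set set" where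
  "orbit B = (\<lambda>g. g ` B) ` PSL"

lemma self_in_orbit: "B \<in> orbit B"
  unfolding orbit_def using aff_in_PSL[OF one_nonzero_square, of 0]
  by (auto simp: aff_1_0 intro!: rev_image_eqI)

lemma PSL_image_orbit:
  assumes "g \<in> PSL" "X \<in> orbit B"
  shows "g ` X \<in> orbit B"
proof -
  from assms(2) obtain h where "h \<in> PSL" "X = h ` B"
    unfolding orbit_def by blast
  then have "g ` X = (g \<circ> h) ` B" "g \<circ> h \<in> PSL"
    using assms(1) by (simp_all add: image_comp PSL_comp)
  then show ?thesis
    unfolding orbit_def by (rule image_eqI)
qed

lemma card_orbit_block: "X \<in> orbit B \<Longrightarrow> card X = card B"
  unfolding orbit_def using bij_PSL bij_is_inj
  by (auto intro!: card_image intro: inj_on_subset)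

text \<open>A point of \<open>T\<close> can be moved to infinity. The other two points \<open>x\<close> and \<open>y\<close> go to 0 and 1, in this
  order, under an affine map with factor \<open>1 / (y - x)\<close>; this factor or its negative is a square,
  and since \<open>T\<close> is not ordered, \<open>x\<close> and \<open>y\<close> may be exchanged.\<close>

lemma PSL_3_homogeneous:
  fixes T :: "'a::finite_field option set"
  assumes q: "CARD('a) mod 4 = 3" and T: "card T = 3"
  shows "\<exists>g \<in> PSL. g ` T = {None, Some 0, Some 1}"
proof -
  obtain g :: "'a option \<Rightarrow> _" where g: "g \<in> PSL" "None \<in> g ` T"
  proof (cases "None \<in> T")
    case True
    show ?thesis
      by (rule that[of id]) (use True aff_in_PSL[OF one_nonzero_square, of 0] in \<open>auto simp: aff_1_0\<close>)
  next
    case False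
    then obtain x where "Some x \<in> T"
      using T by (metis card.empty ex_in_conv option.exhaust zero_neq_numeral)
    moreover have "(aff 1 0 \<circ> neg_inv \<circ> aff 1 (- x)) (Some x) = None"
      by simp
    ultimately show ?thesis
      using that[OF big_cell_in_PSL[OF one_nonzero_square]] by (metis imageI)
  qed
  have "card (g ` T) = 3"
    using T card_image[OF inj_on_subset[OF bij_is_inj[OF bij_PSL[OF g(1)]], of T]] by simp
  then have "card (g ` T - {None}) = 2"
    using g(2) by simp
  then obtain p q where pq: "g ` T - {None} = {p, q}" "p \<noteq> q"
    by (auto simp: card_2_iff)
  have "p \<in> g ` T - {None}" "q \<in> g ` T - {None}"
    by (simp_all add: pq(1))
  then have "p \<noteq> None" "q \<noteq> None"
    by simp_all
  moreover have "g ` T = {None, p, q}"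
    using g(2) by (simp only: insert_Diff flip: pq(1))
  ultimately obtain x y where xy: "g ` T = {None, Some x, Some y}" "x \<noteq> y"
    using pq(2) by auto
  have *: "\<exists>h \<in> PSL. h ` T = {None, Some 0, Some 1}"
    if "g ` T = {None, Some x, Some y}" "y - x \<in> nonzero_squares" for x y
  proof
    let ?h = "aff (1 / (y - x)) (- x / (y - x))"
    have "y - x \<noteq> 0"
      using that(2) by auto
    then have "y / (y - x) - x / (y - x) = 1"
      by (simp flip: diff_divide_distrib)
    then have "?h ` g ` T = {None, Some 0, Some 1}"
      unfolding that(1) by simp
    then show "(?h \<circ> g) ` T = {None, Some 0, Some 1}"
      by (simp add: image_comp)
    show "?h \<circ> g \<in> PSL"
      using that(2) g(1) by (intro aff_comp_PSL nonzero_squares_divide) auto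
  qed
  have "y - x \<in> nonzero_squares \<or> x - y \<in> nonzero_squares"
    using square_or_neg_square[OF q, of "y - x"] xy(2) by simp
  then show ?thesis
    using *[of x y] *[of y x] xy(1) by (metis insert_commute)
qed

lemma orbit_is_3_design:
  fixes B :: "'a::finite_field option set"
  assumes q: "CARD('a) mod 4 = 3"
  shows "is_3_design (CARD('a) + 1) (card B)
    (card {X \<in> orbit B. {None, Some 0, Some 1} \<subseteq> X}) (UNIV, orbit B)"
proof -
  have invariant: "card {X \<in> orbit B. T \<subseteq> X} = card {X \<in> orbit B. g ` T \<subseteq> X}"
    if "g \<in> PSL" for g T
  proof -
    have inj: "inj g" using bij_PSL[OF that] by (rule bij_is_inj)
    have "inj_on ((`) g) (orbit B)"
      using inj by (auto simp: inj_on_def inj_image_eq_iff)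
    moreover have "(`) g ` orbit B \<subseteq> orbit B"
      using PSL_image_orbit[OF that] by blast
    ultimately have "(`) g ` orbit B = orbit B"
      by (intro endo_inj_surj) auto
    then have "{X \<in> orbit B. g ` T \<subseteq> X} = {X \<in> (`) g ` orbit B. g ` T \<subseteq> X}"
      by simp
    also have "\<dots> = (`) g ` {X \<in> orbit B. T \<subseteq> X}"
      using inj_image_subset_iff[OF inj] by blast
    finally have "(`) g ` {X \<in> orbit B. T \<subseteq> X} = {X \<in> orbit B. g ` T \<subseteq> X}" ..
    then show ?thesis
      using card_image[of "(`) g" "{X \<in> orbit B. T \<subseteq> X}"] inj
      by (simp add: inj_on_def inj_image_eq_iff)
  qed
  have "card {X \<in> orbit B. T \<subseteq> X} = card {X \<in> orbit B. {None, Some 0, Some 1} \<subseteq> X}"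
    if T: "card T = 3" for T
  proof -
    obtain g :: "'a option \<Rightarrow> _" where "g \<in> PSL" "g ` T = {None, Some 0, Some 1}"
      using PSL_3_homogeneous[OF q T] by blast
    then show ?thesis
      using invariant[of g T] by (simp only:)
  qed
  moreover have "CARD('a option) = CARD('a) + 1"
    by (simp add: card_UNIV_option)
  ultimately show ?thesis
    unfolding is_3_design_def prod.case using card_orbit_block finite by blast
qed

text \<open>The inequality half of the orbit-stabilizer theorem, for a subset of the stabilizer.\<close>

lemma card_orbit_mult_stabilizer_le:
  fixes B :: "'a::{field,finite} option set"
  assumes H: "H \<subseteq> PSL" "\<And>h. h \<in> H \<Longrightarrow> h ` B = B"
  shows "card (orbit B) * card H \<le> card (PSL :: ('a option \<Rightarrow> 'a option) set)"
proof -
  have "card H \<le> card {g \<in> PSL. g ` B = X}" if "X \<in> orbit B" for X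
  proof -
    from that obtain g where g: "g \<in> PSL" "X = g ` B"
      unfolding orbit_def by blast
    have "g \<circ> h \<in> PSL \<and> (g \<circ> h) ` B = X" if "h \<in> H" for h
      using that H(1) g by (auto simp only: PSL_comp H(2) image_comp[symmetric])
    then have "(\<lambda>h. g \<circ> h) ` H \<subseteq> {g \<in> PSL. g ` B = X}"
      by blast
    moreover have "inj_on (\<lambda>h. g \<circ> h) H"
      using bij_is_inj[OF bij_PSL[OF g(1)]] by (auto simp: inj_on_def fun_eq_iff inj_def)
    ultimately show ?thesis
      by (intro card_inj_on_le) auto
  qed
  then have "card (orbit B) * card H \<le> (\<Sum>X \<in> orbit B. card {g \<in> PSL. g ` B = X})"
    using sum_mono[of "orbit B" "\<lambda>_. card H"] by simp
  also have "\<dots> = card (PSL :: ('a option \<Rightarrow> 'a option) set)"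
    using sum.group[of PSL "orbit B" "\<lambda>g. g ` B" "\<lambda>_. 1::nat"] by (simp add: orbit_def)
  finally show ?thesis .
qed

section \<open>Counting the blocks through infinity by power sums\<close>

definition through_infinity :: "'a set \<Rightarrow> 'a option set" where
  "through_infinity Z = insert None (Some ` Z)"

lemma aff_image_through_infinity:
  "aff e a ` through_infinity Z = through_infinity ((\<lambda>x. e * x + a) ` Z)"
  unfolding through_infinity_def by (auto simp: image_iff)

lemma through_infinity_inject: "through_infinity Y = through_infinity Z \<longleftrightarrow> Y = Z"
  unfolding through_infinity_def by (auto simp: set_eq_iff)

definition moment :: "nat \<Rightarrow> 'a::comm_semiring_1 set \<Rightarrow> 'a" where
  "moment k Z = (\<Sum>x\<in>Z. x ^ k)"

lemma moment_scale:
  fixes Z :: "'a::field set"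
  assumes "e \<noteq> 0"
  shows "moment k ((*) e ` Z) = e ^ k * moment k Z"
  unfolding moment_def using assms
  by (subst sum.reindex) (auto simp: inj_on_def power_mult_distrib sum_distrib_left)

text \<open>The sum of the elements of \<open>e Z + a\<close> is \<open>card Z \<cdot> a\<close> when \<open>Z\<close> has sum zero, so the translation part
  can be read off from the image.\<close>

lemma centered_affine_images_eqD:
  fixes Z Z' :: "'a::{field,finite} set"
  assumes eq: "(\<lambda>x. e * x + a) ` Z = (\<lambda>x. f * x + b) ` Z'"
    and nz: "e \<noteq> 0" "f \<noteq> 0" and n: "of_nat (card Z) \<noteq> (0::'a)"
    and centered: "moment 1 Z = 0" "moment 1 Z' = 0"
  shows "a = b" "(*) e ` Z = (*) f ` Z'"
proof -
  have mean: "(\<Sum>y \<in> (\<lambda>x. e * x + a) ` Z. y) = of_nat (card Z) * a"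
    if "e \<noteq> 0" "moment 1 Z = 0" for e a :: 'a and Z
    using that by (subst sum.reindex)
      (auto simp: inj_on_def sum.distrib moment_def simp flip: sum_distrib_left)
  have "card ((\<lambda>x. e * x + a) ` Z) = card Z" if "e \<noteq> 0" for e a and Z :: "'a set"
    using that by (intro card_image) (auto simp: inj_on_def)
  then have "card Z = card Z'"
    using eq nz by metis
  then show "a = b"
    using mean[OF nz(1) centered(1), of a] mean[OF nz(2) centered(2), of b] eq n by simp
  have "(*) e ` Z = (\<lambda>y. y - a) ` (\<lambda>x. e * x + a) ` Z" for e a and Z :: "'a set"
    by (simp add: image_image)
  then show "(*) e ` Z = (*) f ` Z'"
    using eq \<open>a = b\<close> by metis
qed

text \<open>An affine image of a set with sum zero determines its translation part, and the quotient of the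
  squared third and the cubed second power sum is invariant under scaling. So different sets in \<open>\<Z>\<close> have
  disjoint affine orbits. The second power sum is multiplied by \<open>e\<^sup>2\<close>, and \<open>e\<^sup>2\<close> determines the nonzero square \<open>e\<close> because \<open>-1\<close> is not a square; so
  these orbits are regular. The members of \<open>\<Y>\<close>, whose second power sum vanishes, lie outside them.\<close>

lemma blocks_through_infinity_ge:
  fixes \<O> :: "'a::finite_field option set set" and \<Y> \<Z> :: "'a set set"
  assumes q: "CARD('a) mod 4 = 3"
    and closed: "\<And>e a X. e \<in> nonzero_squares \<Longrightarrow> X \<in> \<O> \<Longrightarrow> aff e a ` X \<in> \<O>"
    and block: "\<And>Z. Z \<in> \<Y> \<union> \<Z> \<Longrightarrow> through_infinity Z \<in> \<O>"
    and size: "\<And>Z. Z \<in> \<Y> \<union> \<Z> \<Longrightarrow> of_nat (card Z) \<noteq> (0::'a)"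
    and centered: "\<And>Z. Z \<in> \<Y> \<union> \<Z> \<Longrightarrow> moment 1 Z = 0"
    and Y: "\<And>Z. Z \<in> \<Y> \<Longrightarrow> moment 2 Z = 0"
    and Z: "\<And>Z. Z \<in> \<Z> \<Longrightarrow> moment 2 Z \<noteq> 0"
    and inj: "inj_on (\<lambda>Z. (moment 3 Z)\<^sup>2 / (moment 2 Z) ^ 3) \<Z>"
  shows "card (nonzero_squares :: 'a set) * CARD('a) * card \<Z> + card \<Y>
    \<le> card {X \<in> \<O>. None \<in> X}"
proof -
  let ?S = "nonzero_squares :: 'a set"
  let ?f = "\<lambda>(e, a, Z). through_infinity ((\<lambda>x. e * x + a) ` Z) :: 'a option set"
  have S: "e \<noteq> 0" if "e \<in> ?S" for e
    using that by auto
  have "inj_on ?f (?S \<times> UNIV \<times> \<Z>)"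
  proof (rule inj_onI)
    fix x y
    assume xy: "x \<in> ?S \<times> UNIV \<times> \<Z>" "y \<in> ?S \<times> UNIV \<times> \<Z>" "?f x = ?f y"
    obtain e a Z f b Z' where x: "x = (e, a, Z)" and y: "y = (f, b, Z')"
      by (metis prod_cases3)
    have ef: "e \<in> ?S" "f \<in> ?S" and ZZ: "Z \<in> \<Z>" "Z' \<in> \<Z>"
      and eq: "(\<lambda>x. e * x + a) ` Z = (\<lambda>x. f * x + b) ` Z'"
      using xy by (simp_all add: x y through_infinity_inject)
    note D = centered_affine_images_eqD[OF eq S[OF ef(1)] S[OF ef(2)] size centered centered]
    have "a = b" and scaled: "(*) e ` Z = (*) f ` Z'"
      using D ZZ by auto
    have m: "e ^ k * moment k Z = f ^ k * moment k Z'" for k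
      using arg_cong[OF scaled, of "moment k"] S ef by (simp add: moment_scale)
    have "(e ^ 3 * moment 3 Z)\<^sup>2 / (e\<^sup>2 * moment 2 Z) ^ 3 = (f ^ 3 * moment 3 Z')\<^sup>2 / (f\<^sup>2 * moment 2 Z') ^ 3"
      by (simp only: m)
    then have "(moment 3 Z)\<^sup>2 / (moment 2 Z) ^ 3 = (moment 3 Z')\<^sup>2 / (moment 2 Z') ^ 3"
      using S[OF ef(1)] S[OF ef(2)] by (simp add: power_mult_distrib flip: power_mult)
    then have "Z = Z'"
      using inj ZZ by (auto simp: inj_on_def)
    then have "e\<^sup>2 = f\<^sup>2"
      using m[of 2] Z ZZ by simp
    then have "e = f"
      using square_eq_imp_eq[OF q] ef by blast
    then show "x = y"
      using \<open>a = b\<close> \<open>Z = Z'\<close> by (simp add: x y)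
  qed
  then have card_f: "card (?f ` (?S \<times> UNIV \<times> \<Z>)) = card ?S * CARD('a) * card \<Z>"
    by (simp add: card_image card_cartesian_product mult.assoc)
  have card_Y: "card (through_infinity ` \<Y>) = card \<Y>"
    by (intro card_image) (auto simp: inj_on_def through_infinity_inject)
  have "?f ` (?S \<times> UNIV \<times> \<Z>) \<inter> through_infinity ` \<Y> = {}"
  proof (rule ccontr)
    assume "\<not> ?thesis"
    then obtain e a Z where *: "e \<in> ?S" "Z \<in> \<Z>" "(\<lambda>x. e * x + a) ` Z \<in> \<Y>"
      by (auto simp: through_infinity_inject)
    define Y' where "Y' = (\<lambda>x. e * x + a) ` Z"
    then have "(\<lambda>x. e * x + a) ` Z = (\<lambda>x. 1 * x + 0) ` Y'" "Y' \<in> \<Y>"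
      using * by simp_all
    then have "(*) e ` Z = (*) 1 ` Y'"
      using centered_affine_images_eqD(2)[of e a Z 1 0 Y'] S size centered * by auto
    then have "e\<^sup>2 * moment 2 Z = 1\<^sup>2 * moment 2 Y'"
      using S[OF *(1)] moment_scale[of _ 2] by (metis one_neq_zero)
    then show False
      using * Y[OF \<open>Y' \<in> \<Y>\<close>] Z[OF *(2)] S by auto
  qed
  then have "card ?S * CARD('a) * card \<Z> + card \<Y>
      = card (?f ` (?S \<times> UNIV \<times> \<Z>) \<union> through_infinity ` \<Y>)"
    using card_f card_Y by (subst card_Un_disjoint) auto
  also have "\<dots> \<le> card {X \<in> \<O>. None \<in> X}"
  proof (rule card_mono)
    show "?f ` (?S \<times> UNIV \<times> \<Z>) \<union> through_infinity ` \<Y> \<subseteq> {X \<in> \<O>. None \<in> X}"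
      using closed block by (auto simp flip: aff_image_through_infinity) (auto simp: through_infinity_def)
  qed simp
  finally show ?thesis .
qed

section \<open>Orbit designs on 80 points\<close>

lemma card_80_16_design:
  assumes "is_3_design 80 16 \<mu> (V, \<B>)"
  shows "7 * card \<B> = 1027 * \<mu>"
proof -
  have "3 * (16 choose 3) = 3 * (560::nat)" "3 * (80 choose 3) = 3 * (82160::nat)"
    using times_binomial_minus1_eq[of 3 16] times_binomial_minus1_eq[of 3 80]
    by (simp_all add: choose_two)
  then show ?thesis
    using design_block_count[OF assms, of "{}"] by simp
qed

text \<open>The parameter is a multiple \<open>35 j\<close> of 35, with \<open>1027 j\<close> blocks through infinity. The stabilizer bounds
  \<open>j\<close> from above and the number of blocks through infinity bounds it from below.\<close>

lemma orbit_design_parameter: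
  fixes B :: "'a::finite_field option set"
  assumes q: "CARD('a) = 79" and B: "card B = 16"
    and H: "H \<subseteq> PSL" "\<And>h. h \<in> H \<Longrightarrow> h ` B = B" and m: "48 \<le> m * card H"
    and r: "1027 * (m - 1) < card {X \<in> orbit B. None \<in> X}"
  shows "is_3_design 80 16 (35 * m) (UNIV, orbit B)"
proof -
  define \<mu> where "\<mu> = card {X \<in> orbit B. {None, Some 0, Some 1} \<subseteq> X}"
  have design: "is_3_design 80 16 \<mu> (UNIV, orbit B)"
    using orbit_is_3_design[of B] q B by (simp add: \<mu>_def)
  have "7 * card (orbit B) = 1027 * \<mu>"
    by (rule card_80_16_design[OF design])
  moreover have *: "card {X \<in> orbit B. None \<in> X} * 105 = 3081 * \<mu>"
    using design_block_count[OF design, of "{None}"] by (simp add: choose_two)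
  moreover have "35 dvd \<mu>"
  proof -
    have "35 * card {X \<in> orbit B. None \<in> X} = 1027 * \<mu>"
      using * by simp
    then have "35 dvd 1027 * \<mu>"
      by (metis dvd_triv_left)
    moreover have "coprime 35 (1027::nat)"
      by (simp add: coprime_iff_gcd_eq_1 gcd_nat.simps)
    ultimately show ?thesis
      by (simp add: coprime_dvd_mult_right_iff)
  qed
  ultimately obtain j where j: "\<mu> = 35 * j" "card (orbit B) = 5135 * j"
    "card {X \<in> orbit B. None \<in> X} = 1027 * j"
    by (auto elim!: dvdE)
  have "card (nonzero_squares :: 'a set) = 39"
    using card_nonzero_squares[where 'a = 'a] q by simp
  then have "card (orbit B) * card H \<le> 246480"
    using card_orbit_mult_stabilizer_le[OF H] card_PSL_le[where 'a = 'a] q by simp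
  then have "j * card H \<le> m * card H"
    using m unfolding j(2) by linarith
  moreover have "0 < card H"
    using m by (metis gr0I mult_0_right not_numeral_le_zero)
  ultimately have "j \<le> m"
    by simp
  moreover have "m \<le> j"
    using r j(3) by simp
  ultimately show ?thesis
    using design j(1) by simp
qed

section \<open>The projective line over the field with 79 elements\<close>

text \<open>A type with 79 elements, from which the field is obtained as the integers modulo the cardinality.\<close>

typedef p79 = "{0..<79::nat}"
  by (rule exI[of _ 0]) simp

lemma CARD_p79: "CARD(p79) = 79"
  using type_definition.card[OF type_definition_p79] by simp

instance p79 :: prime_card
  by standard (simp add: CARD_p79)

type_synonym gf79 = "p79 mod_ring"

lemma CARD_gf79: "CARD(gf79) = 79"
  by (simp add: CARD_p79)

lemma of_int_gf79_eq_0_iff: "(of_int k :: gf79) = 0 \<longleftrightarrow> k mod 79 = 0"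
  by (simp add: of_int_eq_0_iff_char_dvd CARD_p79 mod_eq_0_iff_dvd)

lemma of_int_gf79_eq_iff: "(of_int k :: gf79) = of_int l \<longleftrightarrow> (k - l) mod 79 = 0"
  using of_int_gf79_eq_0_iff[of "k - l"] by simp

definition gf_set :: "int list \<Rightarrow> gf79 set" where
  "gf_set zs = of_int ` set zs"

definition reduced :: "int list \<Rightarrow> bool" where
  "reduced zs \<longleftrightarrow> distinct zs \<and> (\<forall>z\<in>set zs. 0 \<le> z \<and> z < 79)"

lemma inj_on_of_int_gf79: "inj_on (of_int :: int \<Rightarrow> gf79) {0..<79}"
  by (auto simp: inj_on_def of_int_gf79_eq_iff) presburger

lemma inj_on_of_int_reduced: "reduced zs \<Longrightarrow> inj_on (of_int :: int \<Rightarrow> gf79) (set zs)"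
  by (rule inj_on_subset[OF inj_on_of_int_gf79]) (auto simp: reduced_def)

lemma card_gf_set: "reduced zs \<Longrightarrow> card (gf_set zs) = length zs"
  unfolding gf_set_def by (simp add: card_image inj_on_of_int_reduced) (simp add: reduced_def distinct_card)

lemma moment_gf_set: "reduced zs \<Longrightarrow> moment k (gf_set zs) = of_int (\<Sum>z\<leftarrow>zs. z ^ k)"
  unfolding gf_set_def moment_def
  by (simp add: sum.reindex inj_on_of_int_reduced)
    (simp add: reduced_def sum_list_distinct_conv_sum_set)

abbreviation block :: "int list \<Rightarrow> gf79 option set" where
  "block zs \<equiv> through_infinity (gf_set zs)"

lemma block_eq: "block zs = insert None ((Some \<circ> of_int) ` set zs)"
  by (simp add: through_infinity_def gf_set_def image_comp)

lemma card_block: "reduced zs \<Longrightarrow> card (block zs) = Suc (length zs)"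
  unfolding through_infinity_def using card_gf_set[of zs]
  by (subst card_insert_disjoint) (auto simp: gf_set_def card_image)

definition big_cell_map :: "int \<Rightarrow> int \<Rightarrow> int \<Rightarrow> gf79 option \<Rightarrow> gf79 option" where
  "big_cell_map r a d = aff ((of_int r)\<^sup>2) (of_int a) \<circ> neg_inv \<circ> aff 1 (of_int d)"

text \<open>A criterion on integers for an element of the big cell to map one block into another. The point
  \<open>z\<close> goes to infinity if \<open>z + d\<close> vanishes, and otherwise to the \<open>y\<close> with
  \<open>y - a = - r\<^sup>2 / (z + d)\<close>; infinity goes to \<open>a\<close>.\<close>

definition big_cell_maps_block :: "int \<Rightarrow> int \<Rightarrow> int \<Rightarrow> int list \<Rightarrow> int list \<Rightarrow> bool" where
  "big_cell_maps_block r a d zs ys \<longleftrightarrow> r mod 79 \<noteq> 0 \<and> a \<in> set ys \<and>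
     (\<forall>z\<in>set zs. (z + d) mod 79 = 0 \<or> (\<exists>y\<in>set ys. ((y - a) * (z + d) + r * r) mod 79 = 0))"

lemma big_cell_map_PSL: "r mod 79 \<noteq> 0 \<Longrightarrow> big_cell_map r a d \<in> PSL"
  unfolding big_cell_map_def
  by (intro big_cell_in_PSL nonzero_squaresI) (simp add: of_int_gf79_eq_0_iff)

lemma big_cell_map_None [simp]: "big_cell_map r a d None = Some (of_int a)"
  by (simp add: big_cell_map_def)

lemma big_cell_map_image:
  assumes check: "big_cell_maps_block r a d zs ys"
    and "reduced zs" "reduced ys" "length zs = length ys"
  shows "big_cell_map r a d ` block zs = block ys"
proof (rule card_subset_eq)
  have "inj (big_cell_map r a d)"
    using check big_cell_map_PSL[of r a d] bij_PSL bij_is_inj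
    unfolding big_cell_maps_block_def by blast
  then show "card (big_cell_map r a d ` block zs) = card (block ys)"
    using assms by (simp add: card_image[OF inj_on_subset] card_block)
  have "big_cell_map r a d (Some (of_int z)) \<in> block ys" if z: "z \<in> set zs" for z
  proof (cases "(z + d) mod 79 = 0")
    case True
    then have "of_int z + of_int d = (0 :: gf79)"
      using of_int_gf79_eq_0_iff[of "z + d"] by simp
    then show ?thesis
      by (simp add: big_cell_map_def block_eq)
  next
    case False
    then have nz: "of_int z + of_int d \<noteq> (0 :: gf79)"
      using of_int_gf79_eq_0_iff[of "z + d"] by simp
    have "(z + d) mod 79 = 0 \<or> (\<exists>y\<in>set ys. ((y - a) * (z + d) + r * r) mod 79 = 0)"
      using check z unfolding big_cell_maps_block_def by (elim conjE) (rule bspec)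
    then have "\<exists>y\<in>set ys. ((y - a) * (z + d) + r * r) mod 79 = 0"
      using False by blast
    then obtain y where y: "y \<in> set ys" "((y - a) * (z + d) + r * r) mod 79 = 0"
      by (rule bexE)
    then have "of_int ((y - a) * (z + d) + r * r) = (0 :: gf79)"
      by (simp only: of_int_gf79_eq_0_iff)
    then have "(of_int y - of_int a) * (of_int z + of_int d) + (of_int r)\<^sup>2 = (0 :: gf79)"
      by (simp only: of_int_add of_int_mult of_int_diff power2_eq_square)
    then have "(of_int r)\<^sup>2 = - ((of_int y - of_int a) * (of_int z + of_int d) :: gf79)"
      by (simp only: eq_neg_iff_add_eq_0 add.commute)
    then have "(of_int r)\<^sup>2 * (- 1 / (of_int z + of_int d)) + of_int a = (of_int y :: gf79)"
      using nz by simp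
    then show ?thesis
      using nz y(1) by (simp add: big_cell_map_def block_eq)
  qed
  moreover have "big_cell_map r a d None \<in> block ys"
    using check by (simp add: big_cell_maps_block_def block_eq)
  ultimately show "big_cell_map r a d ` block zs \<subseteq> block ys"
    unfolding block_eq[of zs] by auto
qed simp

text \<open>The bound on the blocks through infinity in a form whose hypotheses are congruences between
  integers. The factor 3081 is \<open>39 \<cdot> 79\<close>, the number of affine maps with a square factor.\<close>

lemma listed_blocks_through_infinity_ge:
  assumes orbit: "\<And>zs. zs \<in> set ys \<union> set xs \<Longrightarrow> block zs \<in> orbit B"
    and reduced: "\<And>zs. zs \<in> set ys \<union> set xs \<Longrightarrow> reduced zs \<and> length zs = 15"
    and centered: "\<forall>zs\<in>set ys \<union> set xs. sum_list zs mod 79 = 0"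
    and ys: "\<forall>zs\<in>set ys. (\<Sum>z\<leftarrow>zs. z ^ 2) mod 79 = 0"
    and xs: "\<forall>zs\<in>set xs. (\<Sum>z\<leftarrow>zs. z ^ 2) mod 79 \<noteq> 0"
    and inv: "\<forall>zs\<in>set xs. \<forall>zs'\<in>set xs. zs = zs' \<or>
      ((\<Sum>z\<leftarrow>zs. z ^ 3)\<^sup>2 * (\<Sum>z\<leftarrow>zs'. z ^ 2) ^ 3 - (\<Sum>z\<leftarrow>zs'. z ^ 3)\<^sup>2 * (\<Sum>z\<leftarrow>zs. z ^ 2) ^ 3) mod 79 \<noteq> 0"
    and "distinct xs"
  shows "3081 * length xs + card (gf_set ` set ys) \<le> card {X \<in> orbit B. None \<in> X}"
proof -
  let ?j = "\<lambda>Z :: gf79 set. (moment 3 Z)\<^sup>2 / (moment 2 Z) ^ 3"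
  have m2: "moment 2 (gf_set zs) \<noteq> 0" if "zs \<in> set xs" for zs
    using that xs reduced by (simp only: UnI2 moment_gf_set of_int_gf79_eq_0_iff simp_thms)
  have j: "zs = zs'" if "zs \<in> set xs" "zs' \<in> set xs" "?j (gf_set zs) = ?j (gf_set zs')" for zs zs'
  proof -
    have "(moment 3 (gf_set zs))\<^sup>2 * (moment 2 (gf_set zs')) ^ 3 -
        (moment 3 (gf_set zs'))\<^sup>2 * (moment 2 (gf_set zs)) ^ 3 = 0"
      using that m2 by (simp add: frac_eq_eq)
    then have "(of_int ((\<Sum>z\<leftarrow>zs. z ^ 3)\<^sup>2 * (\<Sum>z\<leftarrow>zs'. z ^ 2) ^ 3 - (\<Sum>z\<leftarrow>zs'. z ^ 3)\<^sup>2 * (\<Sum>z\<leftarrow>zs. z ^ 2) ^ 3) :: gf79) = 0"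
      using that reduced by (simp add: moment_gf_set)
    then show ?thesis
      using bspec[OF bspec[OF inv that(1)] that(2)] unfolding of_int_gf79_eq_0_iff by (elim disjE notE)
  qed
  have "card (nonzero_squares :: gf79 set) = 39"
    using card_nonzero_squares[where 'a = gf79] CARD_gf79 by simp
  moreover have "card (gf_set ` set xs) = length xs"
    using j \<open>distinct xs\<close> by (subst card_image) (auto simp: inj_on_def distinct_card)
  moreover have "card (nonzero_squares :: gf79 set) * CARD(gf79) * card (gf_set ` set xs) +
      card (gf_set ` set ys) \<le> card {X \<in> orbit B. None \<in> X}"
  proof (rule blocks_through_infinity_ge)
    fix Z
    assume "Z \<in> gf_set ` set ys \<union> gf_set ` set xs"
    then obtain zs where zs: "Z = gf_set zs" "zs \<in> set ys \<union> set xs"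
      by blast
    then have red: "reduced zs" "length zs = 15"
      using reduced by blast+
    show "through_infinity Z \<in> orbit B"
      using orbit zs by blast
    show "of_nat (card Z) \<noteq> (0 :: gf79)"
      using of_int_gf79_eq_0_iff[of 15] unfolding zs(1) card_gf_set[OF red(1)] red(2) by simp
    have "sum_list zs mod 79 = 0"
      using centered zs(2) by blast
    then show "moment 1 Z = 0"
      unfolding zs(1) moment_gf_set[OF red(1)] of_int_gf79_eq_0_iff by simp
  next
    fix Z
    assume "Z \<in> gf_set ` set ys"
    then obtain zs where zs: "Z = gf_set zs" "zs \<in> set ys"
      by blast
    then have "reduced zs" "(\<Sum>z\<leftarrow>zs. z ^ 2) mod 79 = 0"
      using reduced ys by blast+
    then show "moment 2 Z = 0"
      unfolding zs(1) moment_gf_set[OF \<open>reduced zs\<close>] of_int_gf79_eq_0_iff by simp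
  next
    show "inj_on ?j (gf_set ` set xs)"
      using j by (auto simp: inj_on_def)
  qed (use m2 in \<open>auto simp: CARD_p79 intro!: PSL_image_orbit aff_in_PSL\<close>)
  ultimately show ?thesis
    by (simp add: CARD_p79)
qed

section \<open>Frames made of affine images of one block\<close>

text \<open>The pair \<open>(r, a)\<close> stands for the map \<open>z \<mapsto> r\<^sup>2 z + a\<close>, so that the factor is a square by construction.\<close>

definition affine_image :: "int list \<Rightarrow> int \<times> int \<Rightarrow> int list" where
  "affine_image zs = (\<lambda>(r, a). map (\<lambda>z. (r * r * z + a) mod 79) zs)"

lemma of_int_mod_79: "of_int (k mod 79) = (of_int k :: gf79)"
  by (simp add: of_int_gf79_eq_iff mod_diff_left_eq)

lemma block_affine_image:
  "block (affine_image zs (r, a)) = aff ((of_int r)\<^sup>2) (of_int a) ` block zs"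
  unfolding aff_image_through_infinity
  by (simp add: gf_set_def affine_image_def image_image of_int_mod_79 power2_eq_square)

text \<open>Infinity, 0 and 1 form the triple of the frame, so the incidence patterns have to be told apart only
  for the residues from 2 to 78.\<close>

definition frame_check :: "int list \<Rightarrow> (int \<times> int) list \<Rightarrow> bool" where
  "frame_check zs ps \<longleftrightarrow> (let Is = map (affine_image zs) ps in
     (\<forall>p\<in>set ps. fst p mod 79 \<noteq> 0) \<and> (\<forall>I\<in>set Is. 0 \<in> set I \<and> 1 \<in> set I) \<and>
     distinct (map (\<lambda>x. map (\<lambda>I. x \<in> set I) Is) [2..78]))"

definition affine_frame :: "int list \<Rightarrow> (int \<times> int) list \<Rightarrow>
    (gf79 option \<times> gf79 option \<times> gf79 option) \<times> gf79 option set list" where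
  "affine_frame zs ps = ((None, Some 0, Some 1), map (block \<circ> affine_image zs) ps)"

lemma gf79_cases:
  obtains z where "0 \<le> z" "z < 79" "x = (of_int z :: gf79)"
proof -
  have "(of_int ` {0..<79} :: gf79 set) = UNIV"
    using inj_on_of_int_gf79 CARD_gf79 by (intro card_subset_eq) (auto simp: card_image)
  then have "x \<in> of_int ` {0..<79}"
    by simp
  then show ?thesis
    using that by auto
qed

lemma affine_frame:
  assumes check: "frame_check zs ps" and orbit: "block zs \<in> orbit B"
  shows "frame UNIV (orbit B) (length ps) (affine_frame zs ps)"
    and "separating UNIV (affine_frame zs ps)"
proof -
  note checks = check[unfolded frame_check_def Let_def]
  have nz: "\<forall>p\<in>set ps. fst p mod 79 \<noteq> 0"
    using checks by (rule conjunct1)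
  have mem: "\<forall>I\<in>set (map (affine_image zs) ps). 0 \<in> set I \<and> 1 \<in> set I"
    using checks by (elim conjE)
  have dist: "distinct (map (\<lambda>x. map (\<lambda>I. x \<in> set I) (map (affine_image zs) ps)) [2..78])"
    using checks by (elim conjE)
  have "block (affine_image zs p) \<in> orbit B" if "p \<in> set ps" for p
  proof -
    obtain r a where p: "p = (r, a)"
      by (cases p)
    have "aff ((of_int r)\<^sup>2) (of_int a :: gf79) \<in> PSL"
      using nz that unfolding p by (intro aff_in_PSL nonzero_squaresI) (force simp: of_int_gf79_eq_0_iff)
    then show ?thesis
      unfolding p block_affine_image using orbit by (rule PSL_image_orbit)
  qed
  moreover have "{None, Some 0, Some 1} \<subseteq> block (affine_image zs p)" if "p \<in> set ps" for p
    using bspec[OF mem, of "affine_image zs p"] that image_eqI[of "Some 0" "Some \<circ> (of_int :: int \<Rightarrow> gf79)" 0]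
      image_eqI[of "Some 1" "Some \<circ> (of_int :: int \<Rightarrow> gf79)" 1]
    unfolding block_eq by auto
  ultimately show "frame UNIV (orbit B) (length ps) (affine_frame zs ps)"
    unfolding frame_def affine_frame_def prod.case by auto
  have block_iff: "Some (of_int x) \<in> block (affine_image zs p) \<longleftrightarrow> x \<in> set (affine_image zs p)"
    if "0 \<le> x" "x < 79" for x p
  proof -
    have "of_int x \<in> (of_int ` set (affine_image zs p) :: gf79 set) \<longleftrightarrow> x \<in> set (affine_image zs p)"
      using that by (intro inj_on_image_mem_iff[OF inj_on_of_int_gf79])
        (auto simp: affine_image_def split: prod.splits)
    then show ?thesis
      unfolding block_eq by auto
  qed
  have sep: "p = q" if p: "p \<notin> {None, Some 0, Some 1}" and q: "q \<notin> {None, Some 0, Some 1}"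
    and same: "\<forall>s\<in>set ps. p \<in> block (affine_image zs s) \<longleftrightarrow> q \<in> block (affine_image zs s)" for p q
  proof -
    obtain x y where "p = Some x" "q = Some y"
      using p q by (metis insertI1 option.exhaust)
    moreover obtain a where a: "0 \<le> a" "a < 79" "x = of_int a"
      by (rule gf79_cases)
    moreover obtain b where b: "0 \<le> b" "b < 79" "y = of_int b"
      by (rule gf79_cases)
    ultimately have pq: "p = Some (of_int a)" "q = Some (of_int b)"
      by simp_all
    have "a \<noteq> 0" "a \<noteq> 1" "b \<noteq> 0" "b \<noteq> 1"
      using p q pq by auto
    then have "a \<in> set [2..78]" "b \<in> set [2..78]"
      using a b by (simp_all only: set_upto atLeastAtMost_iff) linarith+
    moreover have "map (\<lambda>I. a \<in> set I) (map (affine_image zs) ps) = map (\<lambda>I. b \<in> set I) (map (affine_image zs) ps)"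
      using same block_iff[OF a(1,2)] block_iff[OF b(1,2)] unfolding pq by simp
    ultimately have "a = b"
      using dist unfolding distinct_map by (metis (no_types, lifting) inj_onD)
    then show ?thesis
      using pq by simp
  qed
  then show "separating UNIV (affine_frame zs ps)"
    unfolding separating_def affine_frame_def prod.case
    by (intro ballI impI sep) (simp_all only: Diff_iff set_map ball_simps comp_apply simp_thms)
qed

section \<open>A dihedral and a cyclic block\<close>

text \<open>With the point at infinity this is an orbit of a dihedral subgroup of order 16, translated so that
  its elements have sum zero.\<close>

definition dihedral_block :: "int list" where
  "dihedral_block = [2, 3, 15, 28, 34, 35, 40, 41, 45, 53, 59, 61, 65, 74, 77]"

text \<open>Triples \<open>(r, a, d)\<close> such that \<open>x \<mapsto> a - r\<^sup>2 / (x + d)\<close> preserves the block. The middle components run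
  through the block: the dihedral group acts regularly on it, so there is one element that takes
  infinity to each finite point.\<close>

definition dihedral_stabilizer :: "(int \<times> int \<times> int) list" where
  "dihedral_stabilizer =
    [(21, 2, 77), (7, 3, 14), (9, 15, 26), (25, 28, 39), (6, 34, 45), (11, 35, 44),
     (25, 40, 51), (28, 41, 38), (1, 45, 34), (9, 53, 64), (34, 59, 20), (5, 61, 18),
     (7, 65, 76), (24, 74, 5), (13, 77, 2)]"

text \<open>The list is short enough for \<open>(80\<^sup>3 \<cdot> 665\<^sup>1\<^sup>5)\<^sup>2\<close> to stay far below \<open>80!\<close>. Each affine map in it sends two
  elements of the block to 0 and 1, so all images pass through 0, 1 and infinity.\<close>

definition dihedral_frame :: "(int \<times> int) list" where
  "dihedral_frame =
    [(32, 45), (4, 71), (8, 5), (6, 40), (10, 26), (2, 57), (24, 65), (20, 11), (28, 12),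
     (12, 77), (15, 25), (35, 10), (9, 10), (16, 22), (19, 51)]"

text \<open>A union of five cosets of the group \<open>{1, 23, 55}\<close> of cube roots of unity modulo 79, chosen so that the
  five images in \<open>cyclic_block_images\<close> have different invariants. Each coset has vanishing first and second
  power sums.\<close>

definition cyclic_block :: "int list" where
  "cyclic_block = [8, 18, 19, 20, 26, 30, 40, 42, 45, 51, 58, 65, 67, 70, 73]"

text \<open>For each of the five cosets, a point \<open>-d\<close> of it is sent to infinity and the image of the block is
  then translated by \<open>a\<close> so that its finite points have sum zero. The pair is \<open>(a, d)\<close>, followed by the
  finite points.\<close>

definition cyclic_block_images :: "((int \<times> int) \<times> int list) list" where
  "cyclic_block_images =
    [((61, 49), [0, 2, 3, 13, 14, 15, 18, 28, 53, 59, 61, 69, 70, 72, 76]),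
     ((13, 61), [1, 3, 11, 12, 13, 21, 36, 42, 51, 52, 54, 55, 59, 69, 74]),
     ((29, 71), [7, 11, 21, 22, 29, 33, 40, 43, 46, 47, 59, 61, 66, 72, 75]),
     ((73, 59), [1, 7, 21, 22, 24, 27, 34, 36, 54, 55, 65, 69, 70, 73, 74]),
     ((41, 39), [0, 1, 4, 5, 12, 19, 22, 25, 26, 29, 41, 45, 49, 58, 59])]"

text \<open>These affine maps are applied to the first of the blocks in \<open>cyclic_block_images\<close>.\<close>

definition cyclic_frame :: "(int \<times> int) list" where
  "cyclic_frame =
    [(22, 22), (21, 21), (20, 69), (10, 44), (3, 23), (12, 37), (23, 8), (3, 76), (13, 40),
     (9, 52), (32, 6), (18, 2), (15, 77), (15, 21), (17, 46)]"

lemma in_block_iff: "x \<in> block zs \<longleftrightarrow> x = None \<or> (\<exists>z\<in>set zs. x = Some (of_int z))"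
  unfolding block_eq by auto

lemma dihedral_checks:
  "reduced dihedral_block" "length dihedral_block = 15"
  "sum_list dihedral_block mod 79 = 0" "(\<Sum>z\<leftarrow>dihedral_block. z ^ 2) mod 79 \<noteq> 0"
  "map (fst \<circ> snd) dihedral_stabilizer = dihedral_block"
  "\<forall>(r, a, d)\<in>set dihedral_stabilizer. big_cell_maps_block r a d dihedral_block dihedral_block"
  by (code_simp, code_simp, code_simp, code_simp, code_simp, code_simp)

lemma dihedral_frame_check: "frame_check dihedral_block dihedral_frame"
  by code_simp

lemma length_dihedral_frame: "length dihedral_frame = 15"
  by code_simp

text \<open>The orbit of infinity under the stabilizer is the whole block, so the stabilizer has at least 16
  elements. The single affine orbit of the block has 3081 members, and this exceeds \<open>2 \<cdot> 1027\<close>.\<close>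

lemma dihedral_design:
  "is_3_design 80 16 105 (UNIV, orbit (block dihedral_block))"
proof -
  let ?B = "block dihedral_block"
  let ?H = "{g \<in> PSL. g ` ?B = ?B}"
  have card_B: "card ?B = 16"
    by (simp add: card_block dihedral_checks)
  have "?B \<subseteq> (\<lambda>g. g None) ` ?H"
  proof
    fix x
    assume "x \<in> ?B"
    then consider "x = None" | a where "a \<in> set dihedral_block" "x = Some (of_int a)"
      unfolding in_block_iff by blast
    then show "x \<in> (\<lambda>g. g None) ` ?H"
    proof cases
      case 1
      have "aff 1 0 \<in> ?H"
        by (simp add: aff_in_PSL) (simp add: aff_1_0)
      then show ?thesis
        unfolding 1 by (rule rev_image_eqI) simp
    next
      case 2
      then have "a \<in> (fst \<circ> snd) ` set dihedral_stabilizer"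
        by (simp only: dihedral_checks flip: set_map)
      then obtain r d where "(r, a, d) \<in> set dihedral_stabilizer"
        by auto
      then have check: "big_cell_maps_block r a d dihedral_block dihedral_block"
        using dihedral_checks(6) by fast
      then have "big_cell_map r a d \<in> ?H"
        using big_cell_map_image[OF check dihedral_checks(1,1) refl] big_cell_map_PSL
        by (simp add: big_cell_maps_block_def)
      then show ?thesis
        unfolding 2 by (rule rev_image_eqI) simp
    qed
  qed
  then have "16 \<le> card ?H"
    using surj_card_le[of ?H ?B] card_B by simp
  moreover have "3081 * length [dihedral_block] + card (gf_set ` set []) \<le> card {X \<in> orbit ?B. None \<in> X}"
    by (rule listed_blocks_through_infinity_ge) (use dihedral_checks in \<open>simp_all add: self_in_orbit\<close>)
  ultimately have "is_3_design 80 16 (35 * 3) (UNIV, orbit ?B)"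
    using card_B by (intro orbit_design_parameter[where H = ?H]) (auto simp: CARD_p79)
  then show ?thesis
    by simp
qed

lemma cyclic_checks:
  "reduced cyclic_block" "length cyclic_block = 15"
  "sum_list cyclic_block mod 79 = 0" "(\<Sum>z\<leftarrow>cyclic_block. z ^ 2) mod 79 = 0"
  "\<forall>r\<in>set [1, 23, 55]. set (affine_image cyclic_block (r, 0)) = set cyclic_block"
  "\<forall>((a, d), zs)\<in>set cyclic_block_images. big_cell_maps_block 1 a d cyclic_block zs \<and>
     reduced zs \<and> length zs = 15 \<and> sum_list zs mod 79 = 0 \<and> (\<Sum>z\<leftarrow>zs. z ^ 2) mod 79 \<noteq> 0"
  "distinct (map snd cyclic_block_images)" "length cyclic_block_images = 5"
  by code_simp+

lemma cyclic_invariants_check: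
  "\<forall>zs\<in>set (map snd cyclic_block_images). \<forall>zs'\<in>set (map snd cyclic_block_images). zs = zs' \<or>
      ((\<Sum>z\<leftarrow>zs. z ^ 3)\<^sup>2 * (\<Sum>z\<leftarrow>zs'. z ^ 2) ^ 3 - (\<Sum>z\<leftarrow>zs'. z ^ 3)\<^sup>2 * (\<Sum>z\<leftarrow>zs. z ^ 2) ^ 3) mod 79 \<noteq> 0"
  by code_simp

lemma cyclic_frame_check: "frame_check (snd (hd cyclic_block_images)) cyclic_frame"
  by code_simp

lemma length_cyclic_frame: "length cyclic_frame = 15"
  by code_simp

lemma cyclic_block_image_in_orbit:
  assumes "zs \<in> set (map snd cyclic_block_images)"
  shows "block zs \<in> orbit (block cyclic_block)"
proof -
  obtain a d where "((a, d), zs) \<in> set cyclic_block_images"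
    using assms by auto
  then have zs: "big_cell_maps_block 1 a d cyclic_block zs" "reduced zs" "length zs = 15"
    using cyclic_checks(6) by fast+
  then have "big_cell_map 1 a d ` block cyclic_block = block zs"
    using cyclic_checks(1,2) by (intro big_cell_map_image) auto
  then show ?thesis
    using PSL_image_orbit[OF big_cell_map_PSL self_in_orbit, of 1 a d "block cyclic_block"] by simp
qed

text \<open>The cube roots of unity give three elements of the stabilizer. The five images of the block give
  \<open>5 \<cdot> 3081 = 15 \<cdot> 1027\<close> blocks through infinity, and the block itself, on which the second power
  sum vanishes, is one more.\<close>

lemma cyclic_design:
  "is_3_design 80 16 560 (UNIV, orbit (block cyclic_block))"
proof -
  let ?B = "block cyclic_block"
  let ?h = "\<lambda>r :: int. aff ((of_int r)\<^sup>2) 0 :: gf79 option \<Rightarrow> gf79 option"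
  let ?H = "?h ` {1, 23, 55}"
  have card_B: "card ?B = 16"
    by (simp add: card_block cyclic_checks)
  have "?H \<subseteq> PSL"
    by (auto intro!: aff_in_PSL nonzero_squaresI simp: of_int_gf79_eq_0_iff simp del: of_int_numeral)
  moreover have "g ` ?B = ?B" if g: "g \<in> ?H" for g
  proof -
    obtain r where "g = ?h r" "r \<in> {1, 23, 55}"
      using g by (rule imageE)
    then have r: "r \<in> set [1, 23, 55]" "g = ?h r"
      by simp_all
    have "g ` ?B = block (affine_image cyclic_block (r, 0))"
      unfolding block_affine_image r(2) by simp
    then show ?thesis
      using bspec[OF cyclic_checks(5) r(1)] by (simp add: block_eq)
  qed
  moreover have "card ?H = 3"
  proof -
    have "r = s" if "r \<in> {1, 23, 55}" "s \<in> {1, 23, 55}" "?h r = ?h s" for r s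
    proof -
      have "of_int (r\<^sup>2) = (of_int (s\<^sup>2) :: gf79)"
        using fun_cong[OF that(3), of "Some 1"] by simp
      then have "(r\<^sup>2 - s\<^sup>2) mod 79 = 0"
        by (simp only: of_int_gf79_eq_iff)
      then show ?thesis
        using that(1,2) by auto
    qed
    then have "inj_on ?h {1, 23, 55}"
      by (intro inj_onI)
    then show ?thesis
      by (subst card_image) auto
  qed
  moreover have "3081 * length (map snd cyclic_block_images) + card (gf_set ` set [cyclic_block])
      \<le> card {X \<in> orbit ?B. None \<in> X}"
  proof (rule listed_blocks_through_infinity_ge)
    show "block zs \<in> orbit ?B" if "zs \<in> set [cyclic_block] \<union> set (map snd cyclic_block_images)" for zs
      using that cyclic_block_image_in_orbit self_in_orbit by auto
  qed (use cyclic_checks cyclic_invariants_check in \<open>auto\<close>)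
  then have "1027 * (16 - 1) < card {X \<in> orbit ?B. None \<in> X}"
    by (simp add: cyclic_checks)
  ultimately have "is_3_design 80 16 (35 * 16) (UNIV, orbit ?B)"
    using card_B by (intro orbit_design_parameter[where H = ?H]) (auto simp: CARD_p79)
  then show ?thesis
    by simp
qed

section \<open>Forty-four designs\<close>

text \<open>The left-hand side counts the permutations that 43 isomorphism classes or an overlap of the two
  parts can account for; here \<open>15405 = 5135 \<cdot> 3\<close> and \<open>82160 = 5135 \<cdot> 16\<close> are the numbers of blocks.\<close>

lemma frames_and_overlaps_do_not_exhaust_permutations:
  "43 * ((80 ^ 3 * 665 ^ 15) * (80 ^ 3 * 665 ^ 15)) + 15405 * 82160 * (fact 16 * fact 64) < (fact 80 :: nat)"
  by (simp add: fact_numeral)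

theorem theorem4p3:
  "\<exists>\<D> :: nat incidence_structure set.
     card \<D> \<ge> 44 \<and>
     (\<forall>D\<in>\<D>. is_3_design 80 16 665 D) \<and>
     pairwise (\<lambda>D E. \<not> isomorphic D E) \<D>"
proof -
  let ?V = "{0..<80} :: nat set"
  let ?P = "orbit (block dihedral_block)" and ?F = "affine_frame dihedral_block dihedral_frame"
  let ?R = "orbit (block cyclic_block)"
  let ?G = "affine_frame (snd (hd cyclic_block_images)) cyclic_frame"
  have "CARD(gf79 option) = 80"
    by (simp add: card_UNIV_option CARD_p79)
  \<comment> \<open>The points of the projective line are relabelled by natural numbers.\<close>
  then obtain h :: "gf79 option \<Rightarrow> nat" where h: "bij_betw h UNIV ?V"
    using ex_bij_betw_finite_nat[of "UNIV :: gf79 option set"] by auto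
  have "hd cyclic_block_images \<in> set cyclic_block_images"
    using cyclic_checks(8) by (intro hd_in_set) auto
  then have "block (snd (hd cyclic_block_images)) \<in> ?R"
    by (intro cyclic_block_image_in_orbit) simp
  note F = affine_frame[OF dihedral_frame_check self_in_orbit, unfolded length_dihedral_frame]
    and G = affine_frame[OF cyclic_frame_check this, unfolded length_cyclic_frame]
  have P: "is_3_design 80 16 105 (?V, (`) h ` ?P)" and R: "is_3_design 80 16 560 (?V, (`) h ` ?R)"
    using design_image[OF _ h] dihedral_design cyclic_design by blast+
  have "frame ?V ((`) h ` ?P) 15 (frame_image h ?F)" "frame ?V ((`) h ` ?R) 15 (frame_image h ?G)"
    using F(1) G(1) h by (auto intro!: frame_frame_image simp: bij_betw_def)
  moreover have "separating ?V (frame_image h ?F)" "separating ?V (frame_image h ?G)"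
    using separating_frame_image[OF F h] separating_frame_image[OF G h] by simp_all
  moreover have "card ((`) h ` ?P) = 15405" "card ((`) h ` ?R) = 82160"
    using card_80_16_design[OF P] card_80_16_design[OF R] by simp_all
  then have "43 * ((80 ^ 3 * (105 + 560) ^ 15) * (80 ^ 3 * (105 + 560) ^ 15)) +
      card ((`) h ` ?P) * card ((`) h ` ?R) * (fact 16 * fact (80 - 16)) < (fact 80 :: nat)"
    using frames_and_overlaps_do_not_exhaust_permutations by simp
  ultimately have "\<exists>\<D> :: nat incidence_structure set. card \<D> > 43 \<and>
      (\<forall>D\<in>\<D>. is_3_design 80 16 (105 + 560) D) \<and> pairwise (\<lambda>D E. \<not> isomorphic D E) \<D>"
    using P R by (intro many_nonisomorphic_merges)
  then obtain \<D> :: "nat incidence_structure set" where "card \<D> > 43"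
    "\<forall>D\<in>\<D>. is_3_design 80 16 (105 + 560) D" "pairwise (\<lambda>D E. \<not> isomorphic D E) \<D>"
    by (elim exE conjE)
  then show ?thesis
    by (intro exI[of _ \<D>]) simp
qed

end
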